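(* Let $L$ be a free Lie algebra of rank greater than $2$ over a field $K$. Then the Diophantine problem for $L$ is undecidable: there is no algorithm which, given a finite system of equations over $L$, decides whether it has a solution in $L$.
   Context: An equation over $L$ is an equality of two Lie-algebra terms (built from variables and constants of $L$ using $+$, scalar multiplication and the Lie product $[\cdot,\cdot]$). The Diophantine problem for $L$ asks for an algorithm which, given a finite system of such equations with constants from a fixed computable subset of $L$, decides whether the system has a solution in $L$.
   Formalization: The fixed computable subset of constants is required to contain at least three of the free generators; without some such condition the claim fails, since with 0 as the only constant every system is solvable. *)

theory Defs
  imports Complex_Main "HOL-Library.Nat_Bijection"
begin

section \<open>Algorithms: partial recursive functions\<close>

datatype recf =
    RZero
  | RSucc
  | RProj nat
  | RComp recf "recf list"
  | RPrim recf recf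
  | RMin recf

text \<open>\<open>computes f xs y\<close>: the program \<open>f\<close>, run on the arguments \<open>xs\<close>, halts with output \<open>y\<close>.
  Minimisation is Kleene's: all values below the returned one must be defined and nonzero.\<close>

inductive computes :: "recf \<Rightarrow> nat list \<Rightarrow> nat \<Rightarrow> bool" where
  zero: "computes RZero xs 0"
| succ: "computes RSucc (x # xs) (Suc x)"
| proj: "i < length xs \<Longrightarrow> computes (RProj i) xs (xs ! i)"
| comp: "\<lbrakk>list_all2 (\<lambda>g y. computes g xs y) gs ys; computes f ys z\<rbrakk> \<Longrightarrow> computes (RComp f gs) xs z"
| prim_0: "computes f xs y \<Longrightarrow> computes (RPrim f g) (0 # xs) y"
| prim_Suc: "\<lbrakk>computes (RPrim f g) (n # xs) y; computes g (n # y # xs) z\<rbrakk>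
    \<Longrightarrow> computes (RPrim f g) (Suc n # xs) z"
| min: "\<lbrakk>computes f (n # xs) 0; \<forall>m<n. \<exists>y. computes f (m # xs) (Suc y)\<rbrakk> \<Longrightarrow> computes (RMin f) xs n"

inductive_cases computes_elims:
  "computes RZero xs z" "computes RSucc xs z" "computes (RProj i) xs z" "computes (RComp f gs) xs z"
  "computes (RPrim f g) (0 # xs) z" "computes (RPrim f g) (Suc n # xs) z" "computes (RMin f) xs z"

lemma computes_deterministic:
  assumes "computes f xs y" "computes f xs y'"
  shows "y = y'"
  using assms
proof (induction arbitrary: y' rule: computes.induct)
  case (comp xs gs ys f z)
  from comp.prems obtain ys' where ys': "list_all2 (\<lambda>g y. computes g xs y) gs ys'" "computes f ys' y'"
    by (elim computes_elims) blast
  have "ys = ys'"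
    using comp.IH(1) ys'(1) by (auto simp: list_all2_conv_all_nth intro!: nth_equalityI)
  then show ?case
    using comp.IH(2) ys'(2) by blast
next
  case (prim_Suc f g n xs y z)
  from prim_Suc.prems obtain u where u: "computes (RPrim f g) (n # xs) u" "computes g (n # u # xs) y'"
    by (elim computes_elims) blast
  with prim_Suc.IH show ?case by blast
next
  case (min f n xs)
  from min.prems have y': "computes f (y' # xs) 0" "\<forall>m<y'. \<exists>y. computes f (m # xs) (Suc y)"
    by (elim computes_elims(7), blast)+
  have "\<not> n < y'"
    using y'(2) min.IH(1) by fastforce
  moreover have "\<not> y' < n"
    using y'(1) min.IH(2) by fastforce
  ultimately show ?case by simp
next
  case (zero xs)
  then show ?case by (elim computes_elims) simp
next
  case (succ x xs)
  then show ?case by (elim computes_elims) simp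
next
  case (proj i xs)
  from proj.prems show ?case by (elim computes_elims) simp
next
  case (prim_0 f xs y g)
  from prim_0.prems have "computes f xs y'" by (elim computes_elims)
  then show ?case by (rule prim_0.IH)
qed

text \<open>An algorithm deciding \<open>P\<close> on inputs presented through the coding \<open>code\<close>; its behaviour on
  numbers that are not codes is unconstrained.\<close>

definition decidable_via :: "('i \<Rightarrow> nat) \<Rightarrow> ('i \<Rightarrow> bool) \<Rightarrow> bool" where
  "decidable_via code P \<longleftrightarrow> (\<exists>f. \<forall>x. computes f [code x] (if P x then 1 else 0))"

text \<open>No effective presentation of the field or of the algebra is available in general, so a
  computable set of constants is one given by a numbering (possibly with repetitions) for which
  equality of the numbered elements is decidable.\<close>

definition computable_numbering :: "(nat \<Rightarrow> 'a) \<Rightarrow> bool" where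
  "computable_numbering \<nu> \<longleftrightarrow> decidable_via prod_encode (\<lambda>(i, j). \<nu> i = \<nu> j)"


section \<open>Lie algebras and Lie terms\<close>

locale lie_algebra = vector_space scale
  for scale :: "'k::field \<Rightarrow> 'l::ab_group_add \<Rightarrow> 'l" +
  fixes bracket :: "'l \<Rightarrow> 'l \<Rightarrow> 'l"
  assumes bracket_add_left: "bracket (x + y) z = bracket x z + bracket y z"
    and bracket_add_right: "bracket x (y + z) = bracket x y + bracket x z"
    and bracket_scale_left: "bracket (scale a x) y = scale a (bracket x y)"
    and bracket_scale_right: "bracket x (scale a y) = scale a (bracket x y)"
    and bracket_self: "bracket x x = 0"
    and jacobi: "bracket x (bracket y z) + bracket y (bracket z x) + bracket z (bracket x y) = 0"

datatype ('k, 'a) lie_term =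
    Zero
  | Atom 'a
  | Add "('k, 'a) lie_term" "('k, 'a) lie_term"
  | Scale 'k "('k, 'a) lie_term"
  | Bracket "('k, 'a) lie_term" "('k, 'a) lie_term"

primrec lie_eval ::
  "('k \<Rightarrow> 'l \<Rightarrow> 'l) \<Rightarrow> ('l \<Rightarrow> 'l \<Rightarrow> 'l) \<Rightarrow> ('a \<Rightarrow> 'l) \<Rightarrow> ('k, 'a) lie_term \<Rightarrow> 'l::ab_group_add" where
  "lie_eval scale bracket f Zero = 0"
| "lie_eval scale bracket f (Atom a) = f a"
| "lie_eval scale bracket f (Add s t) = lie_eval scale bracket f s + lie_eval scale bracket f t"
| "lie_eval scale bracket f (Scale c t) = scale c (lie_eval scale bracket f t)"
| "lie_eval scale bracket f (Bracket s t) =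
     bracket (lie_eval scale bracket f s) (lie_eval scale bracket f t)"


section \<open>Free Lie algebras\<close>

text \<open>The congruence on terms generated by the axioms of Lie algebras over \<open>'k\<close>.\<close>

inductive lie_eq :: "('k::field, 'a) lie_term \<Rightarrow> ('k, 'a) lie_term \<Rightarrow> bool" where
  refl: "lie_eq t t"
| sym: "lie_eq s t \<Longrightarrow> lie_eq t s"
| trans: "lie_eq s t \<Longrightarrow> lie_eq t u \<Longrightarrow> lie_eq s u"
| cong_add: "lie_eq s s' \<Longrightarrow> lie_eq t t' \<Longrightarrow> lie_eq (Add s t) (Add s' t')"
| cong_scale: "lie_eq t t' \<Longrightarrow> lie_eq (Scale c t) (Scale c t')"
| cong_bracket: "lie_eq s s' \<Longrightarrow> lie_eq t t' \<Longrightarrow> lie_eq (Bracket s t) (Bracket s' t')"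
| add_assoc: "lie_eq (Add (Add s t) u) (Add s (Add t u))"
| add_commute: "lie_eq (Add s t) (Add t s)"
| add_zero: "lie_eq (Add Zero t) t"
| add_minus: "lie_eq (Add (Scale (- 1) t) t) Zero"
| scale_add_right: "lie_eq (Scale c (Add s t)) (Add (Scale c s) (Scale c t))"
| scale_add_left: "lie_eq (Scale (c + d) t) (Add (Scale c t) (Scale d t))"
| scale_scale: "lie_eq (Scale c (Scale d t)) (Scale (c * d) t)"
| scale_one: "lie_eq (Scale 1 t) t"
| bracket_add_left: "lie_eq (Bracket (Add s t) u) (Add (Bracket s u) (Bracket t u))"
| bracket_add_right: "lie_eq (Bracket s (Add t u)) (Add (Bracket s t) (Bracket s u))"
| bracket_scale_left: "lie_eq (Bracket (Scale c s) t) (Scale c (Bracket s t))"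
| bracket_scale_right: "lie_eq (Bracket s (Scale c t)) (Scale c (Bracket s t))"
| bracket_self: "lie_eq (Bracket t t) Zero"
| jacobi: "lie_eq (Add (Add (Bracket s (Bracket t u)) (Bracket t (Bracket u s)))
    (Bracket u (Bracket s t))) Zero"

text \<open>The family \<open>g\<close> freely generates the Lie algebra: it generates it, and the only relations among
  the \<open>g x\<close> are the consequences of the Lie algebra axioms. The universal property and the
  existence of a free Lie algebra on any \<open>'x\<close> are proved below.\<close>

locale free_lie_algebra = lie_algebra scale bracket
  for scale :: "'k::field \<Rightarrow> 'l::ab_group_add \<Rightarrow> 'l" and bracket :: "'l \<Rightarrow> 'l \<Rightarrow> 'l" +
  fixes g :: "'x \<Rightarrow> 'l"
  assumes generating: "\<exists>t. lie_eval scale bracket g t = v"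
    and no_relations: "lie_eval scale bracket g s = lie_eval scale bracket g t \<Longrightarrow> lie_eq s t"

lemma (in lie_algebra) lie_eq_sound:
  "lie_eq s t \<Longrightarrow> lie_eval scale bracket f s = lie_eval scale bracket f t"
proof (induction rule: lie_eq.induct)
  case (add_minus t)
  show ?case by (simp add: scale_minus_left)
next
  case (jacobi s t u)
  show ?case unfolding lie_eval.simps by (rule lie_algebra.jacobi[OF lie_algebra_axioms])
qed (simp_all add: add.assoc add.commute scale_right_distrib scale_left_distrib
    bracket_add_left bracket_add_right bracket_scale_left bracket_scale_right bracket_self)

definition lie_hom ::
  "('k \<Rightarrow> 'l \<Rightarrow> 'l) \<Rightarrow> ('l \<Rightarrow> 'l \<Rightarrow> 'l) \<Rightarrow> ('k \<Rightarrow> 'm \<Rightarrow> 'm) \<Rightarrow> ('m \<Rightarrow> 'm \<Rightarrow> 'm) \<Rightarrow>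
    ('l::ab_group_add \<Rightarrow> 'm::ab_group_add) \<Rightarrow> bool" where
  "lie_hom scale bracket scale' bracket' h \<longleftrightarrow>
    (\<forall>x y. h (x + y) = h x + h y) \<and> (\<forall>c x. h (scale c x) = scale' c (h x)) \<and>
    (\<forall>x y. h (bracket x y) = bracket' (h x) (h y))"

lemma lie_hom_eval:
  assumes "lie_hom scale bracket scale' bracket' h"
  shows "h (lie_eval scale bracket f t) = lie_eval scale' bracket' (\<lambda>a. h (f a)) t"
proof -
  have "h 0 + h 0 = h 0"
    using assms by (metis add_0 lie_hom_def)
  then show ?thesis
    using assms by (induction t) (auto simp: lie_hom_def)
qed

lemma (in free_lie_algebra) universal_property:
  fixes scale' :: "'k \<Rightarrow> 'm::ab_group_add \<Rightarrow> 'm" and f :: "'x \<Rightarrow> 'm"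
  assumes "lie_algebra scale' bracket'"
  shows "\<exists>!h. lie_hom scale bracket scale' bracket' h \<and> (\<forall>x. h (g x) = f x)"
proof (rule ex_ex1I)
  interpret M: lie_algebra scale' bracket' by fact
  let ?e = "lie_eval scale bracket g" and ?e' = "lie_eval scale' bracket' f"
  define h where "h v = ?e' (SOME t. ?e t = v)" for v
  have h: "h (?e t) = ?e' t" for t
    unfolding h_def by (rule M.lie_eq_sound[OF no_relations]) (rule someI, rule HOL.refl)
  have "h (x + y) = h x + h y" "h (scale c x) = scale' c (h x)"
    "h (bracket x y) = bracket' (h x) (h y)" for x y c
  proof -
    obtain s t where st: "?e s = x" "?e t = y" using generating by blast
    show "h (x + y) = h x + h y" using h[of "Add s t"] h[of s] h[of t] st by simp
    show "h (scale c x) = scale' c (h x)" using h[of "Scale c s"] h[of s] st by simp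
    show "h (bracket x y) = bracket' (h x) (h y)"
      using h[of "Bracket s t"] h[of s] h[of t] st by simp
  qed
  moreover have "h (g x) = f x" for x using h[of "Atom x"] by simp
  ultimately show "\<exists>h. lie_hom scale bracket scale' bracket' h \<and> (\<forall>x. h (g x) = f x)"
    unfolding lie_hom_def by blast
next
  fix h h'
  assume h: "lie_hom scale bracket scale' bracket' h \<and> (\<forall>x. h (g x) = f x)"
    and h': "lie_hom scale bracket scale' bracket' h' \<and> (\<forall>x. h' (g x) = f x)"
  show "h = h'"
  proof
    fix v
    obtain t where "lie_eval scale bracket g t = v" using generating by blast
    then show "h v = h' v"
      using lie_hom_eval[of scale bracket scale' bracket' h g t]
        lie_hom_eval[of scale bracket scale' bracket' h' g t] h h' by auto
  qed
qed

quotient_type (overloaded) ('k, 'x) free_lie = "('k::field, 'x) lie_term" / lie_eq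
  by (intro equivpI reflpI sympI transpI) (blast intro: lie_eq.refl lie_eq.sym lie_eq.trans)+

instantiation free_lie :: (field, type) ab_group_add
begin

lift_definition zero_free_lie :: "('a, 'b) free_lie" is Zero .
lift_definition plus_free_lie :: "('a, 'b) free_lie \<Rightarrow> ('a, 'b) free_lie \<Rightarrow> ('a, 'b) free_lie" is Add
  by (rule lie_eq.cong_add)
lift_definition uminus_free_lie :: "('a, 'b) free_lie \<Rightarrow> ('a, 'b) free_lie" is "Scale (- 1)"
  by (rule lie_eq.cong_scale)
definition minus_free_lie :: "('a, 'b) free_lie \<Rightarrow> ('a, 'b) free_lie \<Rightarrow> ('a, 'b) free_lie" where
  "minus_free_lie x y = x + - y"

instance
  by standard
    (simp add: minus_free_lie_def | transfer, rule lie_eq.add_assoc lie_eq.add_commute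
      lie_eq.add_zero lie_eq.add_minus)+

end

lift_definition free_scale :: "'k::field \<Rightarrow> ('k, 'x) free_lie \<Rightarrow> ('k, 'x) free_lie" is Scale
  by (rule lie_eq.cong_scale)
lift_definition free_bracket ::
  "('k::field, 'x) free_lie \<Rightarrow> ('k, 'x) free_lie \<Rightarrow> ('k, 'x) free_lie" is Bracket
  by (rule lie_eq.cong_bracket)
lift_definition free_gen :: "'x \<Rightarrow> ('k::field, 'x) free_lie" is Atom .

lemma lie_eval_free_gen: "lie_eval free_scale free_bracket free_gen t = abs_free_lie t"
  by (induction t) (simp_all add: zero_free_lie.abs_eq plus_free_lie.abs_eq free_scale.abs_eq
      free_bracket.abs_eq free_gen.abs_eq)

lemma free_lie_algebra_free_lie:
  "free_lie_algebra free_scale free_bracket (free_gen :: 'x \<Rightarrow> ('k::field, 'x) free_lie)"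
proof
  fix c d :: 'k and x y z :: "('k, 'x) free_lie"
  show "free_scale c (x + y) = free_scale c x + free_scale c y"
    by transfer (rule lie_eq.scale_add_right)
  show "free_scale (c + d) x = free_scale c x + free_scale d x"
    by transfer (rule lie_eq.scale_add_left)
  show "free_scale c (free_scale d x) = free_scale (c * d) x"
    by transfer (rule lie_eq.scale_scale)
  show "free_scale 1 x = x"
    by transfer (rule lie_eq.scale_one)
  show "free_bracket (x + y) z = free_bracket x z + free_bracket y z"
    by transfer (rule lie_eq.bracket_add_left)
  show "free_bracket x (y + z) = free_bracket x y + free_bracket x z"
    by transfer (rule lie_eq.bracket_add_right)
  show "free_bracket (free_scale c x) y = free_scale c (free_bracket x y)"
    by transfer (rule lie_eq.bracket_scale_left)
  show "free_bracket x (free_scale c y) = free_scale c (free_bracket x y)"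
    by transfer (rule lie_eq.bracket_scale_right)
  show "free_bracket x x = 0"
    by transfer (rule lie_eq.bracket_self)
  show "free_bracket x (free_bracket y z) + free_bracket y (free_bracket z x)
      + free_bracket z (free_bracket x y) = 0"
    by transfer (rule lie_eq.jacobi)
  show "\<exists>t. lie_eval free_scale free_bracket free_gen t = x"
    unfolding lie_eval_free_gen by (metis Quotient3_abs_rep Quotient3_free_lie)
next
  fix s t :: "('k, 'x) lie_term"
  assume "lie_eval free_scale free_bracket free_gen s = lie_eval free_scale free_bracket free_gen t"
  then show "lie_eq s t"
    unfolding lie_eval_free_gen by (simp add: free_lie.abs_eq_iff)
qed


section \<open>Equations and the Diophantine problem\<close>

text \<open>An equation over the Lie algebra \<open>'l\<close>: atoms \<open>Inl n\<close> are variables, atoms \<open>Inr c\<close> constants.\<close>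

type_synonym ('k, 'l) lie_equation = "('k, nat + 'l) lie_term \<times> ('k, nat + 'l) lie_term"

definition has_solution ::
  "('k \<Rightarrow> 'l \<Rightarrow> 'l) \<Rightarrow> ('l \<Rightarrow> 'l \<Rightarrow> 'l) \<Rightarrow> ('k, 'l::ab_group_add) lie_equation list \<Rightarrow> bool" where
  "has_solution scale bracket E \<longleftrightarrow>
    (\<exists>v :: nat \<Rightarrow> 'l. \<forall>(s, t) \<in> set E.
      lie_eval scale bracket (case_sum v id) s = lie_eval scale bracket (case_sum v id) t)"

text \<open>An algorithm receives an equation with the scalar \<open>\<sigma> i\<close> and the constant \<open>\<nu> j\<close> represented by
  their indices \<open>i\<close> and \<open>j\<close>.\<close>

type_synonym equation_syntax = "(nat, nat) lie_equation"

primrec term_code :: "(nat, nat + nat) lie_term \<Rightarrow> nat" where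
  "term_code Zero = prod_encode (0, 0)"
| "term_code (Atom a) = prod_encode (1, sum_encode a)"
| "term_code (Add s t) = prod_encode (2, prod_encode (term_code s, term_code t))"
| "term_code (Scale i t) = prod_encode (3, prod_encode (i, term_code t))"
| "term_code (Bracket s t) = prod_encode (4, prod_encode (term_code s, term_code t))"

definition system_code :: "equation_syntax list \<Rightarrow> nat" where
  "system_code E = list_encode (map (\<lambda>(s, t). prod_encode (term_code s, term_code t)) E)"

lemma inj_term_code: "inj term_code"
proof (rule injI)
  show "term_code s = term_code t \<Longrightarrow> s = t" for s t
  proof (induction s arbitrary: t)
    case Zero
    then show ?case by (cases t) simp_all
  next
    case (Atom a)
    then show ?case by (cases t) (simp_all add: sum_encode_eq)
  next
    case (Add s1 s2)
    then show ?case by (cases t) simp_all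
  next
    case (Scale c s)
    then show ?case by (cases t) simp_all
  next
    case (Bracket s1 s2)
    then show ?case by (cases t) simp_all
  qed
qed

lemma inj_system_code: "inj system_code"
proof (rule injI)
  have "inj (\<lambda>(s, t). prod_encode (term_code s, term_code t))"
    by (rule injI) (auto simp: inj_eq[OF inj_term_code])
  then show "system_code E = system_code F \<Longrightarrow> E = F" for E F
    by (simp add: system_code_def list_encode_eq inj_map_eq_map)
qed

definition interpret_term ::
  "(nat \<Rightarrow> 'k) \<Rightarrow> (nat \<Rightarrow> 'l) \<Rightarrow> (nat, nat + nat) lie_term \<Rightarrow> ('k, nat + 'l) lie_term" where
  "interpret_term \<sigma> \<nu> = map_lie_term \<sigma> (map_sum id \<nu>)"

definition diophantine_problem_decidable ::
  "('k \<Rightarrow> 'l \<Rightarrow> 'l) \<Rightarrow> ('l \<Rightarrow> 'l \<Rightarrow> 'l::ab_group_add) \<Rightarrow> (nat \<Rightarrow> 'k) \<Rightarrow> (nat \<Rightarrow> 'l) \<Rightarrow> bool" where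
  "diophantine_problem_decidable scale bracket \<sigma> \<nu> \<longleftrightarrow>
    decidable_via system_code
      (\<lambda>E. has_solution scale bracket (map (map_prod (interpret_term \<sigma> \<nu>) (interpret_term \<sigma> \<nu>)) E))"

end

theory Submission
  imports Defs "HOL-Computational_Algebra.Polynomial" "HOL-Computational_Algebra.Primes"
    "HOL-Library.Infinite_Set" "HOL-Library.Function_Algebras" "HOL-Library.Countable"
begin

text \<open>Write \<open>a, b, c\<close> for three of the free generators and \<open>d = [b, c]\<close>. Modulo \<open>[a, L] + [d, L]\<close>
  the elements \<open>[ad\<^sub>a\<^sup>x b, [d, ad\<^sub>a\<^sup>y c]]\<close> behave like monomials \<open>X\<^sup>x Y\<^sup>y\<close>: transporting powers of
  \<open>ad\<^sub>a\<close> across the outer bracket, they can be written as \<open>[b, v]\<close> or as \<open>[w, c]\<close>, and then bracketing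
  \<open>v\<close> or \<open>w\<close> with \<open>a\<close> multiplies by \<open>X\<close> or \<open>Y\<close>. The monomials with fixed \<open>x\<close> or fixed \<open>y\<close> have
  the forms \<open>[[ad\<^sub>a\<^sup>x b, d], u]\<close> and \<open>[u, [d, ad\<^sub>a\<^sup>y c]]\<close>. So every instruction of a two-counter machine,
  zero tests included, is a linear family of relations parametrised by one variable, and the
  linear system with one equation per machine state says that the initial and the final configuration
  differ by a combination of transitions. A run of the machine solves it. Conversely, a solution is
  mapped to upper triangular \<open>5 \<times> 5\<close> matrices over \<open>K[X, Y]\<close>, where \<open>d\<close> is a matrix unit and
  the corner entry of \<open>[a, L] + [d, L]\<close> vanishes; applying to the corner entry of the equation of
  state \<open>q\<close> the functional that is \<open>1\<close> on the monomials from which the machine halts and summing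
  over all \<open>q\<close> shows that the machine reaches the final configuration.

  Undecidability follows by diagonalisation: if \<open>f\<close> decided solvability, the system for the machine
  computing \<open>f\<close> on the self-application of its input, applied to its own code, would be
  solvable iff it is not.\<close>

section \<open>Primitive recursion\<close>

text \<open>The closure properties that follow are those from which
  \<open>substitution_recursive\<close> assembles its computation on codes.\<close>

definition total_recursive :: "nat \<Rightarrow> (nat list \<Rightarrow> nat) \<Rightarrow> bool" where
  "total_recursive k F \<longleftrightarrow> (\<exists>f. \<forall>xs. length xs = k \<longrightarrow> computes f xs (F xs))"

lemma total_recursive_cong:
  "(\<And>xs. length xs = k \<Longrightarrow> F xs = G xs) \<Longrightarrow> j = k \<Longrightarrow> total_recursive j F \<Longrightarrow>
    total_recursive k G"
  unfolding total_recursive_def by auto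

lemma total_recursive_const: "total_recursive k (\<lambda>xs. n)"
proof (induction n)
  case 0
  then show ?case unfolding total_recursive_def using computes.zero by blast
next
  case (Suc n)
  then obtain f where "\<forall>xs. length xs = k \<longrightarrow> computes f xs n"
    unfolding total_recursive_def by blast
  then have "\<forall>xs. length xs = k \<longrightarrow> computes (RComp RSucc [f]) xs (Suc n)"
    by (auto intro!: computes.comp[where ys = "[n]"] computes.succ)
  then show ?case unfolding total_recursive_def by blast
qed

lemma total_recursive_proj: "i < k \<Longrightarrow> total_recursive k (\<lambda>xs. xs ! i)"
  unfolding total_recursive_def by (rule exI[of _ "RProj i"]) (auto intro: computes.proj)

lemma total_recursive_comp1:
  assumes "total_recursive 1 (\<lambda>xs. F (xs ! 0))" "total_recursive k G"
  shows "total_recursive k (\<lambda>xs. F (G xs))"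
proof -
  obtain f g where f: "\<And>xs. length xs = 1 \<Longrightarrow> computes f xs (F (xs ! 0))"
    and g: "\<And>xs. length xs = k \<Longrightarrow> computes g xs (G xs)"
    using assms unfolding total_recursive_def by blast
  have "computes (RComp f [g]) xs (F (G xs))" if "length xs = k" for xs
    using f[of "[G xs]"] g[OF that] by (intro computes.comp[where ys = "[G xs]"]) auto
  then show ?thesis unfolding total_recursive_def by blast
qed

lemma total_recursive_comp2:
  assumes "total_recursive 2 (\<lambda>xs. F (xs ! 0) (xs ! 1))" "total_recursive k G" "total_recursive k H"
  shows "total_recursive k (\<lambda>xs. F (G xs) (H xs))"
proof -
  obtain f g h where f: "\<And>xs. length xs = 2 \<Longrightarrow> computes f xs (F (xs ! 0) (xs ! 1))"
    and g: "\<And>xs. length xs = k \<Longrightarrow> computes g xs (G xs)"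
    and h: "\<And>xs. length xs = k \<Longrightarrow> computes h xs (H xs)"
    using assms unfolding total_recursive_def by blast
  have "computes (RComp f [g, h]) xs (F (G xs) (H xs))" if "length xs = k" for xs
    using f[of "[G xs, H xs]"] g[OF that] h[OF that]
    by (intro computes.comp[where ys = "[G xs, H xs]"]) auto
  then show ?thesis unfolding total_recursive_def by blast
qed

lemma total_recursive_Suc:
  "total_recursive k F \<Longrightarrow> total_recursive k (\<lambda>xs. Suc (F xs))"
proof (erule total_recursive_comp1[rotated])
  have "computes RSucc xs (Suc (xs ! 0))" if "length xs = 1" for xs
    using that by (cases xs) (auto intro: computes.succ)
  then show "total_recursive 1 (\<lambda>xs. Suc (xs ! 0))"
    unfolding total_recursive_def by blast
qed

lemma total_recursive_rec:
  assumes "total_recursive k F" "total_recursive (k + 2) G"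
  shows "total_recursive (Suc k) (\<lambda>xs. rec_nat (F (tl xs)) (\<lambda>n y. G (n # y # tl xs)) (xs ! 0))"
proof -
  obtain f g where f: "\<And>xs. length xs = k \<Longrightarrow> computes f xs (F xs)"
    and g: "\<And>xs. length xs = k + 2 \<Longrightarrow> computes g xs (G xs)"
    using assms unfolding total_recursive_def by blast
  have "computes (RPrim f g) (n # xs) (rec_nat (F xs) (\<lambda>n y. G (n # y # xs)) n)"
    if "length xs = k" for n xs
    by (induction n) (auto intro!: computes.prim_0 computes.prim_Suc f g simp: that)
  then have "computes (RPrim f g) xs (rec_nat (F (tl xs)) (\<lambda>n y. G (n # y # tl xs)) (xs ! 0))"
    if "length xs = Suc k" for xs
    using that by (cases xs) auto
  then show ?thesis unfolding total_recursive_def by blast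
qed

text \<open>Iteration is primitive recursion whose step ignores the counter. It yields addition,
  powers and the codes of iterated brackets.\<close>

lemma total_recursive_funpow:
  assumes F: "total_recursive 1 (\<lambda>xs. F (xs ! 0))" and G: "total_recursive k G"
    and H: "total_recursive k H"
  shows "total_recursive k (\<lambda>xs. (F ^^ G xs) (H xs))"
proof -
  have "total_recursive (Suc 1) (\<lambda>xs. rec_nat (tl xs ! 0) (\<lambda>n y. F ((n # y # tl xs) ! 1)) (xs ! 0))"
    by (rule total_recursive_rec) (auto intro!: total_recursive_proj total_recursive_comp1[OF F])
  moreover have "rec_nat b (\<lambda>n y. F y) n = (F ^^ n) b" for b n
    by (induction n) auto
  ultimately have "total_recursive 2 (\<lambda>xs. (F ^^ (xs ! 0)) (xs ! 1))"
    by (elim total_recursive_cong[rotated 2]) (auto simp: nth_tl)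
  from total_recursive_comp2[OF this G H] show ?thesis .
qed

lemma total_recursive_add:
  assumes "total_recursive k F" "total_recursive k G"
  shows "total_recursive k (\<lambda>xs. F xs + G xs)"
proof -
  have "(Suc ^^ n) m = n + m" for n m by (induction n) auto
  then show ?thesis
    using total_recursive_funpow[of Suc, OF total_recursive_Suc assms] total_recursive_proj[of 0 1]
    by simp
qed

lemma total_recursive_mult_const:
  "total_recursive k F \<Longrightarrow> total_recursive k (\<lambda>xs. c * F xs)"
  by (induction c) (auto intro: total_recursive_const total_recursive_add)

lemma total_recursive_power:
  assumes "total_recursive k F"
  shows "total_recursive k (\<lambda>xs. c ^ F xs)"
proof -
  have "(((*) c) ^^ n) 1 = c ^ n" for n by (induction n) auto
  then show ?thesis
    using total_recursive_funpow[of "(*) c", OF _ assms total_recursive_const[where n = 1]]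
      total_recursive_mult_const[OF total_recursive_proj[of 0 1]] by simp
qed

lemma total_recursive_prod_encode:
  assumes "total_recursive k F" "total_recursive k G"
  shows "total_recursive k (\<lambda>xs. prod_encode (F xs, G xs))"
proof -
  \<comment> \<open>\<open>prod_encode (m, n)\<close> is \<open>triangle (m + n) + m\<close>, so
    only the triangular numbers need a recursion.\<close>
  have "total_recursive (Suc 0) (\<lambda>xs. rec_nat ((\<lambda>xs. 0) (tl xs))
      (\<lambda>n y. (\<lambda>ys. ys ! 1 + Suc (ys ! 0)) (n # y # tl xs)) (xs ! 0))"
    by (rule total_recursive_rec)
      (auto intro!: total_recursive_proj total_recursive_const total_recursive_add total_recursive_Suc)
  moreover have "rec_nat 0 (\<lambda>n y. y + Suc n) n = triangle n" for n
    by (induction n) auto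
  ultimately have triangle: "total_recursive 1 (\<lambda>xs. triangle (xs ! 0))" by simp
  show ?thesis
    unfolding prod_encode_def
    using assms by (auto intro!: total_recursive_add total_recursive_comp1[OF triangle])
qed

section \<open>Counter programs\<close>

datatype com = Inc nat | Loop nat "com list"

text \<open>The first component is the program still to be run. Entering a loop already decrements
  its register, so every step multiplies the Goedel number by a prime, divides it by one, or finds
  it not divisible.\<close>

inductive com_step :: "com list \<times> (nat \<Rightarrow> nat) \<Rightarrow> com list \<times> (nat \<Rightarrow> nat) \<Rightarrow> bool" where
  Inc: "com_step (Inc r # K, s) (K, s(r := Suc (s r)))"
| Loop_exit: "s r = 0 \<Longrightarrow> com_step (Loop r cs # K, s) (K, s)"
| Loop_enter: "s r = Suc m \<Longrightarrow> com_step (Loop r cs # K, s) (cs @ Loop r cs # K, s(r := m))"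

text \<open>Quantifying over the continuation \<open>K\<close> reduces sequential composition to
  transitivity.\<close>

definition exec :: "com list \<Rightarrow> (nat \<Rightarrow> nat) \<Rightarrow> (nat \<Rightarrow> nat) \<Rightarrow> bool" where
  "exec cs s s' \<longleftrightarrow> (\<forall>K. com_step\<^sup>*\<^sup>* (cs @ K, s) (K, s'))"

lemma exec_Nil: "exec [] s s"
  by (simp add: exec_def)

lemma exec_append: "exec cs s t \<Longrightarrow> exec ds t u \<Longrightarrow> exec (cs @ ds) s u"
  unfolding exec_def by (auto intro: rtranclp_trans)

lemma exec_Cons: "exec [c] s t \<Longrightarrow> exec ds t u \<Longrightarrow> exec (c # ds) s u"
  using exec_append[of "[c]"] by simp

lemma exec_Inc: "t = s(r := Suc (s r)) \<Longrightarrow> exec [Inc r] s t"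
  by (simp add: exec_def com_step.Inc r_into_rtranclp)

lemma exec_Loop_exit: "s r = 0 \<Longrightarrow> t = s \<Longrightarrow> exec [Loop r cs] s t"
  by (simp add: exec_def com_step.Loop_exit r_into_rtranclp)

lemma exec_Loop_enter:
  assumes "s r = Suc m" "exec cs (s(r := m)) t" "exec [Loop r cs] t u"
  shows "exec [Loop r cs] s u"
proof -
  have "com_step\<^sup>*\<^sup>* (Loop r cs # K, s) (K, u)" for K
  proof -
    have "com_step (Loop r cs # K, s) (cs @ Loop r cs # K, s(r := m))"
      using assms(1) by (rule com_step.Loop_enter)
    also have "com_step\<^sup>*\<^sup>* (cs @ Loop r cs # K, s(r := m)) (Loop r cs # K, t)"
      using assms(2) by (simp add: exec_def)
    also have "com_step\<^sup>*\<^sup>* (Loop r cs # K, t) (K, u)"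
      using assms(3) by (simp add: exec_def)
    finally show ?thesis .
  qed
  then show ?thesis by (simp add: exec_def)
qed

text \<open>\<open>S i\<close> is the state after \<open>i\<close> passes. The body starts after the
  decrement made on entry, hence the value \<open>n - Suc i\<close>.\<close>

lemma exec_Loop_count:
  assumes "\<And>i. i < n \<Longrightarrow> S i r = n - i"
    and "\<And>i. i < n \<Longrightarrow> exec cs ((S i)(r := n - Suc i)) (S (Suc i))" and "S n r = 0"
  shows "exec [Loop r cs] (S 0) (S n)"
proof -
  \<comment> \<open>Here \<open>k\<close> is the number of passes still to come.\<close>
  have "exec [Loop r cs] (S (n - k)) (S n)" if "k \<le> n" for k
    using that
  proof (induction k)
    case 0
    show ?case using assms(3) by (simp add: exec_Loop_exit)
  next
    case (Suc k)
    then have k: "n - Suc k < n" "Suc (n - Suc k) = n - k" by auto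
    show ?case
    proof (rule exec_Loop_enter)
      show "S (n - Suc k) r = Suc k" using assms(1)[OF k(1)] Suc.prems by simp
      show "exec cs ((S (n - Suc k))(r := k)) (S (n - k))"
        using assms(2)[OF k(1)] k(2) Suc.prems by simp
      show "exec [Loop r cs] (S (n - k)) (S n)" using Suc by simp
    qed
  qed
  from this[of n] show ?thesis by simp
qed

section \<open>Register transfers and compilation of recursive functions\<close>

definition clear_reg :: "nat \<Rightarrow> com list" where
  "clear_reg r = [Loop r []]"

definition move_reg :: "nat \<Rightarrow> nat \<Rightarrow> com list" where
  "move_reg a b = [Loop a [Inc b]]"

definition copy_reg :: "nat \<Rightarrow> nat \<Rightarrow> nat \<Rightarrow> com list" where
  "copy_reg a b t = [Loop a [Inc t, Inc b], Loop t [Inc a]]"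

lemma exec_clear_reg: "t = s(r := 0) \<Longrightarrow> exec (clear_reg r) s t"
  using exec_Loop_count[of "s r" "\<lambda>i. s(r := s r - i)" r "[]"]
  by (auto simp: clear_reg_def exec_Nil)

lemma exec_move_reg:
  assumes "a \<noteq> b" "t = s(a := 0, b := s b + s a)"
  shows "exec (move_reg a b) s t"
proof -
  let ?S = "\<lambda>i. s(a := s a - i, b := s b + i)"
  have "exec [Loop a [Inc b]] (?S 0) (?S (s a))"
    using assms(1) by (intro exec_Loop_count exec_Inc) auto
  then show ?thesis using assms by (simp add: move_reg_def)
qed

lemma exec_copy_reg:
  assumes "a \<noteq> b" "a \<noteq> t" "b \<noteq> t" "s t = 0" "u = s(b := s b + s a)"
  shows "exec (copy_reg a b t) s u"
proof -
  let ?S = "\<lambda>i. s(a := s a - i, b := s b + i, t := i)"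
  have "exec [Loop a [Inc t, Inc b]] (?S 0) (?S (s a))"
  proof (rule exec_Loop_count[where S = ?S])
    show "exec [Inc t, Inc b] ((?S i)(a := s a - Suc i)) (?S (Suc i))" for i
      using assms by (intro exec_Cons[OF exec_Inc[OF HOL.refl]] exec_Inc) auto
  qed (use assms in auto)
  moreover have "exec (move_reg t a) (?S (s a)) u"
    using assms by (intro exec_move_reg) auto
  moreover have "?S 0 = s" using assms by auto
  ultimately show ?thesis
    unfolding copy_reg_def move_reg_def by (metis exec_Cons)
qed

text \<open>Argument registers \<open>args\<close>, output register \<open>out\<close> (initially \<open>0\<close>); the registers from \<open>base\<close> on are
  zero before and after and serve as scratch space.\<close>

primrec compile :: "recf \<Rightarrow> nat list \<Rightarrow> nat \<Rightarrow> nat \<Rightarrow> com list" where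
  "compile RZero = (\<lambda>args out base. [])"
| "compile RSucc = (\<lambda>args out base. copy_reg (hd args) out base @ [Inc out])"
| "compile (RProj i) = (\<lambda>args out base. copy_reg (args ! i) out base)"
| "compile (RComp f gs) = (\<lambda>args out base. let top = base + length gs in
     concat (map2 (\<lambda>c r. c args r top) (map compile gs) [base..<top]) @
     compile f [base..<top] out top @ concat (map clear_reg [base..<top]))"
| "compile (RPrim f g) = (\<lambda>args out base.
     compile f (tl args) out (base + 3) @ copy_reg (hd args) (base + 2) (base + 3) @
     [Loop (base + 2) (compile g (base # out # tl args) (base + 1) (base + 3) @
        clear_reg out @ move_reg (base + 1) out @ [Inc base])] @ clear_reg base)"
| "compile (RMin f) = (\<lambda>args out base.
     [Inc (base + 1), Loop (base + 1) (compile f (out # args) base (base + 2) @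
        [Loop base (clear_reg base @ [Inc (base + 1), Inc out])])])"

definition compile_correct :: "recf \<Rightarrow> bool" where
  "compile_correct f \<longleftrightarrow> (\<forall>xs y args out base s. computes f xs y \<longrightarrow> map s args = xs \<longrightarrow>
     set args \<subseteq> {..<base} \<longrightarrow> out < base \<longrightarrow> out \<notin> set args \<longrightarrow> s out = 0 \<longrightarrow>
     (\<forall>r\<ge>base. s r = 0) \<longrightarrow> exec (compile f args out base) s (s(out := y)))"

lemma compile_correctD:
  assumes "compile_correct f" "computes f xs y" "map s args = xs" "set args \<subseteq> {..<base}"
    "out < base" "out \<notin> set args" "s out = 0" "\<And>r. r \<ge> base \<Longrightarrow> s r = 0" "t = s(out := y)"
  shows "exec (compile f args out base) s t"
  using assms unfolding compile_correct_def by blast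

lemma exec_clear_regs:
  "t = (\<lambda>r. if r \<in> set rs then 0 else s r) \<Longrightarrow> exec (concat (map clear_reg rs)) s t"
proof (induction rs arbitrary: s)
  case Nil
  then show ?case by (simp add: exec_Nil)
next
  case (Cons a rs)
  have "exec (concat (map clear_reg rs)) (s(a := 0)) t"
    using Cons.prems by (intro Cons.IH) auto
  then show ?case
    using exec_append[OF exec_clear_reg] by simp
qed

lemma compile_correct_RComp:
  assumes f: "compile_correct f" and gs: "\<And>g. g \<in> set gs \<Longrightarrow> compile_correct g"
  shows "compile_correct (RComp f gs)"
  unfolding compile_correct_def
proof (intro allI impI)
  fix xs y args out base and s :: "nat \<Rightarrow> nat"
  assume "computes (RComp f gs) xs y" and args: "map s args = xs" "set args \<subseteq> {..<base}"
    and out: "out < base" "out \<notin> set args" "s out = 0" and base: "\<forall>r\<ge>base. s r = 0"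
  then obtain ys where ys: "list_all2 (\<lambda>g y. computes g xs y) gs ys" "computes f ys y"
    by (elim computes_elims) blast
  have len: "length ys = length gs" using ys(1) by (simp add: list_all2_lengthD)
  define top where "top = base + length gs"
  \<comment> \<open>State after the first \<open>i\<close> inner programs: their values occupy the
    registers from \<open>base\<close> up to \<open>base + i - 1\<close>.\<close>
  define S where "S i = (\<lambda>r. if base \<le> r \<and> r < base + i then ys ! (r - base) else s r)" for i
  have S_args: "map (S i) args = xs" for i
    unfolding args(1)[symmetric] using args(2) by (auto simp: S_def)
  have "exec (concat (map2 (\<lambda>c r. c args r top) (map compile (take i gs)) [base..<base + i])) s (S i)"
    if "i \<le> length gs" for i
    using that
  proof (induction i)
    case 0
    have "S 0 = s" by (auto simp: S_def)
    then show ?case by (simp add: exec_Nil)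
  next
    case (Suc i)
    then have i: "i < length gs" by simp
    have "exec (compile (gs ! i) args (base + i) top) (S i) (S (Suc i))"
    proof (rule compile_correctD[OF gs])
      show "computes (gs ! i) xs (ys ! i)" using list_all2_nthD[OF ys(1) i] by simp
      show "S (Suc i) = (S i)(base + i := ys ! i)" by (auto simp: S_def)
      show "map (S i) args = xs" by (rule S_args)
    qed (use i args(2) base in \<open>auto simp: top_def S_def\<close>)
    with Suc i show ?case
      by (auto simp: take_Suc_conv_app_nth intro!: exec_append)
  qed
  from this[of "length gs"]
  have "exec (concat (map2 (\<lambda>c r. c args r top) (map compile gs) [base..<top])) s (S (length gs))"
    by (simp add: top_def)
  moreover have "exec (compile f [base..<top] out top) (S (length gs)) ((S (length gs))(out := y))"
  proof (rule compile_correctD[OF f ys(2)])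
    show "map (S (length gs)) [base..<top] = ys"
      by (rule nth_equalityI) (auto simp: S_def top_def len)
  qed (use out base in \<open>auto simp: S_def top_def\<close>)
  moreover have "exec (concat (map clear_reg [base..<top])) ((S (length gs))(out := y)) (s(out := y))"
  proof (rule exec_clear_regs)
    show "s(out := y) = (\<lambda>r. if r \<in> set [base..<top] then 0 else ((S (length gs))(out := y)) r)"
      using out base by (auto simp: S_def top_def)
  qed
  ultimately show "exec (compile (RComp f gs) args out base) s (s(out := y))"
    by (auto simp: Let_def top_def intro!: exec_append)
qed

text \<open>Unfolds the derivation into a table \<open>Y\<close> of intermediate values, the form in
  which \<open>exec_Loop_count\<close> can follow the recursion.\<close>

lemma computes_RPrim_values:
  assumes "computes (RPrim f g) (n # xs) y"
  shows "\<exists>Y. computes f xs (Y 0) \<and> (\<forall>i<n. computes g (i # Y i # xs) (Y (Suc i))) \<and> Y n = y"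
  using assms
proof (induction n arbitrary: y)
  case 0
  then have "computes f xs y" by (elim computes_elims)
  then show ?case by auto
next
  case (Suc n)
  then obtain u where u: "computes (RPrim f g) (n # xs) u" "computes g (n # u # xs) y"
    by (elim computes_elims) blast
  from Suc.IH[OF u(1)] obtain Y where
    "computes f xs (Y 0)" "\<forall>i<n. computes g (i # Y i # xs) (Y (Suc i))" "Y n = u" by blast
  then show ?case using u(2)
    by (intro exI[of _ "Y(Suc n := y)"]) (auto simp: less_Suc_eq)
qed

lemma compile_correct_RPrim:
  assumes f: "compile_correct f" and g: "compile_correct g"
  shows "compile_correct (RPrim f g)"
  unfolding compile_correct_def
proof (intro allI impI)
  fix xs y args out base and s :: "nat \<Rightarrow> nat"
  assume comp: "computes (RPrim f g) xs y" and args: "map s args = xs" "set args \<subseteq> {..<base}"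
    and out: "out < base" "out \<notin> set args" "s out = 0" and base: "\<forall>r\<ge>base. s r = 0"
  obtain n zs where xs: "xs = n # zs" using comp by cases auto
  then obtain a as where as: "args = a # as" "s a = n" "map s as = zs" using args(1) by auto
  have fresh: "r \<notin> set as" if "base \<le> r" for r
    using as(1) args(2) that by auto
  obtain Y where Y: "computes f zs (Y 0)" "\<And>i. i < n \<Longrightarrow> computes g (i # Y i # zs) (Y (Suc i))"
    "Y n = y"
    using computes_RPrim_values[OF comp[unfolded xs]] by blast
  \<comment> \<open>State before pass \<open>i\<close>: current value in \<open>out\<close>,
    recursion counter in \<open>base\<close>, remaining passes in \<open>base + 2\<close>. The next
    value is built in \<open>base + 1\<close> because \<open>g\<close> still reads
    \<open>out\<close>.\<close>
  define S where "S i = s(out := Y i, base := i, base + 2 := n - i)" for i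
  let ?body = "compile g (base # out # as) (base + 1) (base + 3) @
    clear_reg out @ move_reg (base + 1) out @ [Inc base]"
  have body: "exec ?body ((S i)(base + 2 := n - Suc i)) (S (Suc i))" if i: "i < n" for i
  proof -
    let ?s0 = "(S i)(base + 2 := n - Suc i)"
    let ?s1 = "?s0(base + 1 := Y (Suc i))"
    let ?s2 = "?s1(out := 0)"
    let ?s3 = "?s2(base + 1 := 0, out := Y (Suc i))"
    have 1: "exec (compile g (base # out # as) (base + 1) (base + 3)) ?s0 ?s1"
      by (rule compile_correctD[OF g Y(2)[OF i]])
        (use as args out base fresh in \<open>auto simp: S_def\<close>)
    have 2: "exec (clear_reg out) ?s1 ?s2" by (rule exec_clear_reg) simp
    have 3: "exec (move_reg (base + 1) out) ?s2 ?s3"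
      by (rule exec_move_reg) (use out in auto)
    have 4: "exec [Inc base] ?s3 (S (Suc i))"
      by (rule exec_Inc) (use out base in \<open>auto simp: S_def fun_eq_iff\<close>)
    show ?thesis by (rule exec_append[OF 1 exec_append[OF 2 exec_append[OF 3 4]]])
  qed
  have 1: "exec (compile f as out (base + 3)) s (s(out := Y 0))"
    by (rule compile_correctD[OF f Y(1)]) (use as args out base in auto)
  have 2: "exec (copy_reg a (base + 2) (base + 3)) (s(out := Y 0)) (S 0)"
    by (rule exec_copy_reg) (use as args out base in \<open>auto simp: S_def\<close>)
  have 3: "exec [Loop (base + 2) ?body] (S 0) (S n)"
    by (rule exec_Loop_count[where S = S]) (use body in \<open>auto simp: S_def\<close>)
  have 4: "exec (clear_reg base) (S n) (s(out := y))"
    by (rule exec_clear_reg) (use out base Y(3) in \<open>auto simp: S_def fun_eq_iff\<close>)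
  show "exec (compile (RPrim f g) args out base) s (s(out := y))"
    using exec_append[OF 1 exec_append[OF 2 exec_append[OF 3 4]]] by (simp add: as)
qed

text \<open>The flag in \<open>base + 1\<close> is consumed on entering the outer loop and set again
  only if the test value is positive. The inner loop clears its own register in the first pass, so
  it acts as a conditional.\<close>

lemma compile_correct_RMin:
  assumes f: "compile_correct f"
  shows "compile_correct (RMin f)"
  unfolding compile_correct_def
proof (intro allI impI)
  fix xs n args out base and s :: "nat \<Rightarrow> nat"
  assume comp: "computes (RMin f) xs n" and args: "map s args = xs" "set args \<subseteq> {..<base}"
    and out: "out < base" "out \<notin> set args" "s out = 0" and base: "\<forall>r\<ge>base. s r = 0"
  from comp have zero: "computes f (n # xs) 0" and pos: "\<And>m. m < n \<Longrightarrow> \<exists>y. computes f (m # xs) (Suc y)"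
    by (elim computes_elims; blast)+
  define S where "S i = s(out := i, base + 1 := 1)" for i
  let ?test = "compile f (out # args) base (base + 2)"
  let ?next = "[Loop base (clear_reg base @ [Inc (base + 1), Inc out])]"
  let ?loop = "Loop (base + 1) (?test @ ?next)"
  have test: "exec ?test ((S i)(base + 1 := 0)) ((S i)(base + 1 := 0, base := y))"
    if "computes f (i # xs) y" for i y
    by (rule compile_correctD[OF f that]) (use args out base in \<open>auto simp: S_def\<close>)
  have "exec [?loop] (S n) (s(out := n))"
  proof (rule exec_Loop_enter[where m = 0])
    show "exec (?test @ ?next) ((S n)(base + 1 := 0)) (s(out := n))"
    proof (rule exec_append[OF test[OF zero]], rule exec_Loop_exit)
      show "s(out := n) = (S n)(base + 1 := 0, base := 0)"
        using out base by (auto simp: S_def fun_eq_iff)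
    qed simp
    show "exec [?loop] (s(out := n)) (s(out := n))"
      using out base by (intro exec_Loop_exit) auto
  qed (simp add: S_def)
  \<comment> \<open>Induction downwards from the minimum \<open>n\<close>: below it the test value
    is positive, so one pass leads from \<open>S i\<close> to \<open>S (Suc i)\<close>.\<close>
  then have "exec [?loop] (S 0) (s(out := n))"
  proof (rule inc_induct[OF le0, where P = "\<lambda>i. exec [?loop] (S i) (s(out := n))"])
    fix i assume "i < n" and Suc_i: "exec [?loop] (S (Suc i)) (s(out := n))"
    obtain y where y: "computes f (i # xs) (Suc y)" using pos \<open>i < n\<close> by blast
    let ?s1 = "(S i)(base + 1 := 0, base := Suc y)"
    have "exec (clear_reg base @ [Inc (base + 1), Inc out]) (?s1(base := y)) (S (Suc i))"
      by (rule exec_append[OF exec_clear_reg[OF HOL.refl]], rule exec_Cons[OF exec_Inc[OF HOL.refl]], rule exec_Inc)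
        (use out base in \<open>auto simp: S_def fun_eq_iff\<close>)
    moreover have "exec ?next (S (Suc i)) (S (Suc i))"
      using out base by (intro exec_Loop_exit) (auto simp: S_def)
    ultimately have "exec ?next ?s1 (S (Suc i))"
      by (rule exec_Loop_enter[where m = y, rotated]) simp
    with test[OF y] have "exec (?test @ ?next) ((S i)(base + 1 := 0)) (S (Suc i))"
      by (rule exec_append)
    then show "exec [?loop] (S i) (s(out := n))"
      using Suc_i by (rule exec_Loop_enter[where m = 0, rotated]) (simp add: S_def)
  qed
  moreover have "exec [Inc (base + 1)] s (S 0)"
    by (rule exec_Inc) (use out base in \<open>auto simp: S_def fun_eq_iff\<close>)
  ultimately show "exec (compile (RMin f) args out base) s (s(out := n))"
    by (simp add: exec_Cons)
qed

lemma compile_correct: "compile_correct f"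
proof (induction f)
  case RZero
  show ?case unfolding compile_correct_def
  proof (intro allI impI)
    fix xs y args out base and s :: "nat \<Rightarrow> nat"
    assume "computes RZero xs y" and out: "s out = 0"
    then have "y = 0" by (elim computes_elims)
    then show "exec (compile RZero args out base) s (s(out := y))"
      using out by (simp add: exec_Nil fun_upd_idem)
  qed
next
  case RSucc
  show ?case unfolding compile_correct_def
  proof (intro allI impI)
    fix xs y args out base and s :: "nat \<Rightarrow> nat"
    assume comp: "computes RSucc xs y" and args: "map s args = xs" "set args \<subseteq> {..<base}"
      and out: "out < base" "out \<notin> set args" "s out = 0" and base: "\<forall>r\<ge>base. s r = 0"
    from comp obtain x zs where "xs = x # zs" "y = Suc x" by (elim computes_elims) blast
    then obtain a as where as: "args = a # as" "y = Suc (s a)" using args(1) by auto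
    have "exec (copy_reg a out base) s (s(out := s a))"
      using as args out base by (intro exec_copy_reg) auto
    moreover have "exec [Inc out] (s(out := s a)) (s(out := y))"
      using as by (intro exec_Inc) auto
    ultimately show "exec (compile RSucc args out base) s (s(out := y))"
      by (simp add: as(1) exec_append)
  qed
next
  case (RProj i)
  show ?case unfolding compile_correct_def
  proof (intro allI impI)
    fix xs y args out base and s :: "nat \<Rightarrow> nat"
    assume comp: "computes (RProj i) xs y" and args: "map s args = xs" "set args \<subseteq> {..<base}"
      and out: "out < base" "out \<notin> set args" "s out = 0" and base: "\<forall>r\<ge>base. s r = 0"
    from comp have i: "i < length xs" "y = xs ! i" by (elim computes_elims, blast)+
    then have "args ! i \<in> set args" "y = s (args ! i)" using args(1) by auto
    moreover from this(1) have "args ! i < base" "args ! i \<noteq> out" using args(2) out(2) by auto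
    ultimately have "exec (copy_reg (args ! i) out base) s (s(out := y))"
      using out base by (intro exec_copy_reg) auto
    then show "exec (compile (RProj i) args out base) s (s(out := y))" by simp
  qed
next
  case (RComp f gs)
  then show ?case by (intro compile_correct_RComp) auto
next
  case (RPrim f g)
  then show ?case by (rule compile_correct_RPrim)
next
  case (RMin f)
  then show ?case by (rule compile_correct_RMin)
qed

section \<open>Two-counter machines\<close>

datatype kind = KX | KY | ZX | ZY

type_synonym 'q rule = "kind \<times> 'q \<times> nat \<times> 'q \<times> nat"

text \<open>A rule \<open>(k, q, i, q', j)\<close> leads from \<open>point k i x y\<close> in state \<open>q\<close> to \<open>point k j x y\<close> in state \<open>q'\<close>, for
  all \<open>x\<close> and \<open>y\<close>; in the kinds \<open>ZX\<close> and \<open>ZY\<close> one counter is pinned to a constant.\<close>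

fun point :: "kind \<Rightarrow> nat \<Rightarrow> nat \<Rightarrow> nat \<Rightarrow> nat \<times> nat" where
  "point KX i x y = (x + i, y)"
| "point KY i x y = (x, y + i)"
| "point ZX i x y = (i, y)"
| "point ZY i x y = (x, i)"

inductive rule_step :: "'q rule set \<Rightarrow> 'q \<times> nat \<times> nat \<Rightarrow> 'q \<times> nat \<times> nat \<Rightarrow> bool" for R where
  "(k, q, i, q', j) \<in> R \<Longrightarrow> rule_step R (q, point k i x y) (q', point k j x y)"

lemma rule_stepsI:
  "(k, q, i, q', j) \<in> R \<Longrightarrow> u = point k i x y \<Longrightarrow> u' = point k j x y \<Longrightarrow>
    (rule_step R)\<^sup>*\<^sup>* (q, u) (q', u')"
  by (auto intro: rule_step.intros)

section \<open>Goedel numbers of register states\<close>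

definition nth_prime :: "nat \<Rightarrow> nat" where
  "nth_prime = enumerate {p. prime p}"

lemma prime_nth_prime: "prime (nth_prime r)"
  using enumerate_in_set[OF primes_infinite] by (simp add: nth_prime_def)

lemma nth_prime_pos [simp]: "nth_prime r > 0"
  by (simp add: prime_nth_prime prime_gt_0_nat)

lemma nth_prime_eq_iff: "nth_prime r = nth_prime r' \<longleftrightarrow> r = r'"
  unfolding nth_prime_def using enumerate_mono_iff[OF primes_infinite]
  by (metis less_irrefl linorder_neqE_nat)

lemma prime_imp_nth_prime: "prime p \<Longrightarrow> \<exists>r. p = nth_prime r"
  unfolding nth_prime_def using range_enumerate[OF primes_infinite] by auto

text \<open>The first counter holds \<open>N = \<Prod>\<^sub>r p\<^sub>r\<^bsup>s r\<^esup>\<close>, so that incrementing or decrementing a register is a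
  multiplication or division by a prime.\<close>

definition godel :: "(nat \<Rightarrow> nat) \<Rightarrow> nat \<Rightarrow> bool" where
  "godel s N \<longleftrightarrow> N > 0 \<and> (\<forall>r. multiplicity (nth_prime r) N = s r)"

lemma multiplicity_nth_prime:
  "multiplicity (nth_prime r') (nth_prime r) = (if r' = r then 1 else 0)"
  using prime_multiplicity_other[OF prime_nth_prime prime_nth_prime, of r' r]
    prime_nth_prime[of r] by (auto simp: nth_prime_eq_iff)

text \<open>Multiplicities are additive. One direction of the equivalence serves \<open>Inc\<close>,
  the other the decrement on loop entry.\<close>

lemma godel_mult:
  assumes "N > 0"
  shows "godel (s(r := Suc (s r))) (nth_prime r * N) \<longleftrightarrow> godel s N"
proof -
  have "multiplicity (nth_prime r') (nth_prime r * N) =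
      (if r' = r then 1 else 0) + multiplicity (nth_prime r') N" for r'
    using assms nth_prime_pos[of r]
    by (subst prime_elem_multiplicity_mult_distrib)
      (auto simp: prime_nth_prime multiplicity_nth_prime less_imp_neq[OF nth_prime_pos, symmetric])
  then show ?thesis
    using assms by (auto simp: godel_def)
qed

lemma godel_dvd_iff: "godel s N \<Longrightarrow> nth_prime r dvd N \<longleftrightarrow> s r > 0"
  using prime_multiplicity_gt_zero_iff[of "nth_prime r" N] prime_nth_prime[of r]
  by (auto simp: godel_def)

text \<open>A number other than 1 has a prime factor, and every prime is some
  \<open>nth_prime r\<close>. Thus the output 0 is recognised by a single counter value.\<close>

lemma godel_zero_iff:
  assumes "godel s N"
  shows "N = 1 \<longleftrightarrow> (\<forall>r. s r = 0)"
proof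
  assume "\<forall>r. s r = 0"
  then have "\<not> nth_prime r dvd N" for r using godel_dvd_iff[OF assms] by simp
  then show "N = 1"
    using prime_factor_nat[of N] prime_imp_nth_prime by blast
qed (use assms in \<open>auto simp: godel_def\<close>)

lemma godel_power: "godel ((\<lambda>_. 0)(r := n)) (nth_prime r ^ n)"
proof (induction n)
  case 0
  show ?case by (simp add: godel_def)
next
  case (Suc n)
  have "godel (((\<lambda>_. 0)(r := n))(r := Suc (((\<lambda>_. 0)(r := n)) r))) (nth_prime r * nth_prime r ^ n)"
    using Suc.IH by (subst godel_mult) (simp_all del: fun_upd_upd fun_upd_apply)
  moreover have "((\<lambda>_. 0)(r := n))(r := Suc (((\<lambda>_. 0)(r := n)) r)) = (\<lambda>_. 0)(r := Suc n)"
    by auto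
  ultimately show ?case by (metis power_Suc)
qed

section \<open>Rules simulating one command\<close>

fun subtrahend :: "com \<Rightarrow> nat" where
  "subtrahend (Inc r) = 1"
| "subtrahend (Loop r cs) = nth_prime r"

fun addend :: "com \<Rightarrow> nat" where
  "addend (Inc r) = nth_prime r"
| "addend (Loop r cs) = 1"

text \<open>The program to continue with when the division by \<open>subtrahend\<close> is exact. A
  remainder is possible only for a loop, which is then left towards the rest of the program.\<close>

fun next_prog :: "com \<Rightarrow> com list \<Rightarrow> com list" where
  "next_prog (Inc r) K = K"
| "next_prog (Loop r cs) K = cs @ Loop r cs # K"

text \<open>States 0 and 1 move the first counter to the second, scaled by \<open>\<beta> / \<alpha>\<close>; if no remainder is left,
  states 2 and 3 move the result back, otherwise states 4 and 5 restore the original value.\<close>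

fun rules_of :: "com list \<Rightarrow> (nat \<times> com list) rule set" where
  "rules_of [] = {}"
| "rules_of (c # K) = (let Q = c # K; \<alpha> = subtrahend c; \<beta> = addend c in
    {(KX, (0, Q), \<alpha>, (1, Q), 0), (KY, (1, Q), 0, (0, Q), \<beta>), (ZX, (0, Q), 0, (2, Q), 0),
     (KY, (2, Q), 1, (3, Q), 0), (KX, (3, Q), 0, (2, Q), 1), (ZY, (2, Q), 0, (0, next_prog c K), 0),
     (KY, (4, Q), 1, (5, Q), 0), (KX, (5, Q), 0, (4, Q), \<alpha>), (ZY, (4, Q), 0, (0, K), 0)} \<union>
    (\<lambda>k. (ZX, (0, Q), k, (4, Q), k)) ` {0<..<\<alpha>})"

lemma finite_rules_of: "finite (rules_of Q)"
  by (cases Q) (simp_all add: Let_def)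

lemma rule_source: "(k, (m, Q), i, q', j) \<in> rules_of Q' \<Longrightarrow> Q' = Q \<and> Q \<noteq> []"
  by (cases Q') (auto simp: Let_def)

lemma subtrahend_pos: "subtrahend c > 0"
  by (cases c) (auto simp: prime_nth_prime prime_gt_0_nat)

text \<open>Only the states 0, 2 and 4 have several rules. In state 0 these apply to first counters
  at least \<alpha>, equal to 0, or equal to some \<open>k\<close> strictly between; in 2 and 4 they
  separate a positive second counter from 0.\<close>

lemma rules_of_deterministic:
  assumes r: "(k, q, i, q1, j) \<in> rules_of Q" "(k', q, i', q2, j') \<in> rules_of Q"
    and same: "point k i x y = point k' i' x' y'"
  shows "q1 = q2 \<and> point k j x y = point k' j' x' y'"
proof (cases Q)
  case (Cons c K)
  then show ?thesis using r same subtrahend_pos[of c]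
    by (auto simp: Let_def)
qed (use r in simp)

lemma rule_step_deterministic:
  assumes "rule_step (\<Union> (rules_of ` S)) u v" "rule_step (\<Union> (rules_of ` S)) u w"
  shows "v = w"
  using assms(1)
proof cases
  case (1 k q i q1 j x y)
  note first = this
  from assms(2) show ?thesis
  proof cases
    case (1 k' q' i' q2 j' x' y')
    obtain m Q where q: "q = (m, Q)" by (cases q)
    have "(k, q, i, q1, j) \<in> rules_of Q" "(k', q, i', q2, j') \<in> rules_of Q"
      using first 1 rule_source unfolding q by fastforce+
    from rules_of_deterministic[OF this, of x y x' y'] first 1 show ?thesis by auto
  qed
qed

text \<open>The counter is split by Euclidean division. With a remainder, the value reached is the
  original one: only a loop admits \<open>k > 0\<close>, and its \<open>addend\<close> is 1.\<close>

lemma rule_steps_com: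
  assumes R: "rules_of (c # K) \<subseteq> R" and k: "k < subtrahend c"
  shows "(rule_step R)\<^sup>*\<^sup>* ((0, c # K), subtrahend c * t + k, 0)
    (if k = 0 then ((0, next_prog c K), addend c * t, 0)
     else ((0, K), k + subtrahend c * (addend c * t), 0))"
proof -
  let ?s = "rule_step R" and ?\<alpha> = "subtrahend c" and ?\<beta> = "addend c" and ?l = "\<lambda>m. (m :: nat, c # K)"
  have transfer: "?s\<^sup>*\<^sup>* (?l 0, ?\<alpha> * t + k, y) (?l 0, k, y + ?\<beta> * t)" for y
  proof (induction t arbitrary: y)
    case (Suc t)
    have "?s\<^sup>*\<^sup>* (?l 0, ?\<alpha> * Suc t + k, y) (?l 1, ?\<alpha> * t + k, y)"
      by (rule rule_stepsI[where k = KX and i = ?\<alpha> and j = 0, OF subsetD[OF R]]) (auto simp: Let_def)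
    also have "?s\<^sup>*\<^sup>* \<dots> (?l 0, ?\<alpha> * t + k, y + ?\<beta>)"
      by (rule rule_stepsI[where k = KY and i = 0 and j = ?\<beta>, OF subsetD[OF R]]) (auto simp: Let_def)
    also have "?s\<^sup>*\<^sup>* \<dots> (?l 0, k, y + ?\<beta> + ?\<beta> * t)" by (rule Suc.IH)
    finally show ?case by (simp add: algebra_simps)
  qed simp
  have move_back: "?s\<^sup>*\<^sup>* (?l 2, x, y) (?l 2, x + y, 0)" for x y
  proof (induction y arbitrary: x)
    case (Suc y)
    have "?s\<^sup>*\<^sup>* (?l 2, x, Suc y) (?l 3, x, y)"
      by (rule rule_stepsI[where k = KY and i = 1 and j = 0, OF subsetD[OF R]]) (auto simp: Let_def)
    also have "?s\<^sup>*\<^sup>* \<dots> (?l 2, Suc x, y)"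
      by (rule rule_stepsI[where k = KX and i = 0 and j = 1, OF subsetD[OF R]]) (auto simp: Let_def)
    also have "?s\<^sup>*\<^sup>* \<dots> (?l 2, Suc x + y, 0)" by (rule Suc.IH)
    finally show ?case by simp
  qed simp
  have restore: "?s\<^sup>*\<^sup>* (?l 4, x, y) (?l 4, x + ?\<alpha> * y, 0)" for x y
  proof (induction y arbitrary: x)
    case (Suc y)
    have "?s\<^sup>*\<^sup>* (?l 4, x, Suc y) (?l 5, x, y)"
      by (rule rule_stepsI[where k = KY and i = 1 and j = 0, OF subsetD[OF R]]) (auto simp: Let_def)
    also have "?s\<^sup>*\<^sup>* \<dots> (?l 4, x + ?\<alpha>, y)"
      by (rule rule_stepsI[where k = KX and i = 0 and j = ?\<alpha>, OF subsetD[OF R]]) (auto simp: Let_def)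
    also have "?s\<^sup>*\<^sup>* \<dots> (?l 4, x + ?\<alpha> + ?\<alpha> * y, 0)" by (rule Suc.IH)
    finally show ?case by (simp add: algebra_simps)
  qed simp
  show ?thesis
  proof (cases "k = 0")
    case True
    have "?s\<^sup>*\<^sup>* (?l 0, ?\<alpha> * t + k, 0) (?l 0, 0, ?\<beta> * t)" using transfer[of 0] True by simp
    also have "?s\<^sup>*\<^sup>* \<dots> (?l 2, 0, ?\<beta> * t)"
      by (rule rule_stepsI[where k = ZX and i = 0 and j = 0, OF subsetD[OF R]]) (auto simp: Let_def)
    also have "?s\<^sup>*\<^sup>* \<dots> (?l 2, ?\<beta> * t, 0)" using move_back[of 0] by simp
    also have "?s\<^sup>*\<^sup>* \<dots> ((0, next_prog c K), ?\<beta> * t, 0)"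
      by (rule rule_stepsI[where k = ZY and i = 0 and j = 0, OF subsetD[OF R]]) (auto simp: Let_def)
    finally show ?thesis using True by simp
  next
    case False
    have "?s\<^sup>*\<^sup>* (?l 0, ?\<alpha> * t + k, 0) (?l 0, k, ?\<beta> * t)" using transfer[of 0] by simp
    also have "?s\<^sup>*\<^sup>* \<dots> (?l 4, k, ?\<beta> * t)"
      by (rule rule_stepsI[where k = ZX and i = k and j = k, OF subsetD[OF R]])
        (use k False in \<open>auto simp: Let_def\<close>)
    also have "?s\<^sup>*\<^sup>* \<dots> (?l 4, k + ?\<alpha> * (?\<beta> * t), 0)" by (rule restore)
    also have "?s\<^sup>*\<^sup>* \<dots> ((0, K), k + ?\<alpha> * (?\<beta> * t), 0)"
      by (rule rule_stepsI[where k = ZY and i = 0 and j = 0, OF subsetD[OF R]]) (auto simp: Let_def)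
    finally show ?thesis using False by simp
  qed
qed

lemma com_step_simulation:
  assumes step: "com_step (Q, s) (Q', s')" and R: "rules_of Q \<subseteq> R" and N: "godel s N"
  shows "\<exists>N'. godel s' N' \<and> (rule_step R)\<^sup>*\<^sup>* ((0, Q), N, 0) ((0, Q'), N', 0)"
  using step
proof cases
  case (Inc r)
  have "N > 0" using N by (simp add: godel_def)
  then have "godel s' (nth_prime r * N)" using N Inc by (simp add: godel_mult)
  moreover have "(rule_step R)\<^sup>*\<^sup>* ((0, Q), N, 0) ((0, Q'), nth_prime r * N, 0)"
    using rule_steps_com[of "com.Inc r" Q' R 0 N] R Inc by simp
  ultimately show ?thesis by blast
next
  case (Loop_exit r cs)
  let ?p = "nth_prime r"
  have "N mod ?p \<noteq> 0" using godel_dvd_iff[OF N, of r] Loop_exit by (simp add: mod_eq_0_iff_dvd)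
  moreover have "N mod ?p < ?p" by (simp add: prime_nth_prime prime_gt_0_nat)
  ultimately have "(rule_step R)\<^sup>*\<^sup>* ((0, Q), N, 0) ((0, Q'), N, 0)"
    using rule_steps_com[of "Loop r cs" Q' R "N mod ?p" "N div ?p"] R Loop_exit by simp
  then show ?thesis using N Loop_exit by blast
next
  case (Loop_enter r m cs K)
  let ?p = "nth_prime r"
  obtain M where M: "N = ?p * M" using godel_dvd_iff[OF N, of r] Loop_enter by (auto elim: dvdE)
  have "M > 0" using N M by (auto simp: godel_def)
  have "s = s'(r := Suc (s' r))" using Loop_enter by auto
  then have "godel s' M" using N godel_mult[OF \<open>M > 0\<close>, of s' r] M by simp
  moreover have "(rule_step R)\<^sup>*\<^sup>* ((0, Q), N, 0) ((0, Q'), M, 0)"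
    using rule_steps_com[of "Loop r cs" K R 0 M] R Loop_enter M
    by (simp add: prime_nth_prime prime_gt_0_nat)
  ultimately show ?thesis by blast
qed

section \<open>Finiteness of the set of programs met during a run\<close>

definition step_closed :: "com list set \<Rightarrow> bool" where
  "step_closed S \<longleftrightarrow> (\<forall>c K. c # K \<in> S \<longrightarrow> K \<in> S \<and> next_prog c K \<in> S)"

text \<open>Closure is asked only of the elements added to \<open>T\<close>. This lets a loop be put
  into \<open>T\<close> first and its own successors be supplied later.\<close>

definition step_extension :: "com list set \<Rightarrow> com list set \<Rightarrow> bool" where
  "step_extension T S \<longleftrightarrow>
    T \<subseteq> S \<and> finite S \<and> (\<forall>c K. c # K \<in> S - T \<longrightarrow> K \<in> S \<and> next_prog c K \<in> S)"

lemma step_extensionD: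
  "step_extension T S \<Longrightarrow> c # K \<in> S \<Longrightarrow> c # K \<notin> T \<Longrightarrow> K \<in> S \<and> next_prog c K \<in> S"
  by (simp add: step_extension_def)

lemma step_extension_subset: "step_extension T S \<Longrightarrow> T \<subseteq> S"
  and step_extension_finite: "step_extension T S \<Longrightarrow> finite S"
  by (simp_all add: step_extension_def)

lemma step_extensionI:
  assumes "T \<subseteq> S" "finite S"
    and "\<And>c K. c # K \<in> S \<Longrightarrow> c # K \<notin> T \<Longrightarrow> K \<in> S \<and> next_prog c K \<in> S"
  shows "step_extension T S"
  unfolding step_extension_def by (intro conjI allI impI assms(1,2)) (elim DiffE; drule (1) assms(3); simp)+

lemma step_extension_trans:
  assumes TS: "step_extension T S" and SU: "step_extension S U"
  shows "step_extension T U"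
proof (rule step_extensionI)
  fix c K assume cK: "c # K \<in> U" "c # K \<notin> T"
  show "K \<in> U \<and> next_prog c K \<in> U"
  proof (cases "c # K \<in> S")
    case True
    from step_extensionD[OF TS True cK(2)] show ?thesis
      using step_extension_subset[OF SU] by (simp add: subset_eq)
  next
    case False
    with SU cK(1) show ?thesis by (rule step_extensionD)
  qed
qed (use step_extension_subset[OF TS] step_extension_subset[OF SU] step_extension_finite[OF SU] in auto)

definition finitely_extendable :: "com list \<Rightarrow> bool" where
  "finitely_extendable cs \<longleftrightarrow>
    (\<forall>T. \<forall>K\<in>T. finite T \<longrightarrow> (\<exists>S. step_extension T S \<and> cs @ K \<in> S))"

lemma finitely_extendable_append:
  assumes "finitely_extendable cs" "finitely_extendable ds"
  shows "finitely_extendable (cs @ ds)"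
  unfolding finitely_extendable_def
proof (intro allI ballI impI)
  fix T and K :: "com list" assume "finite T" "K \<in> T"
  then obtain S where S: "step_extension T S" "ds @ K \<in> S"
    using assms(2) unfolding finitely_extendable_def by blast
  then have "finite S" by (simp add: step_extension_finite)
  with S(2) obtain S' where "step_extension S S'" "cs @ ds @ K \<in> S'"
    using assms(1) unfolding finitely_extendable_def by blast
  then show "\<exists>S. step_extension T S \<and> (cs @ ds) @ K \<in> S"
    using step_extension_trans[OF S(1)] by auto
qed

lemma finitely_extendable_if_single:
  "\<forall>c\<in>set cs. finitely_extendable [c] \<Longrightarrow> finitely_extendable cs"
proof (induction cs)
  case Nil
  have "step_extension T T" if "finite T" for T using that by (simp add: step_extension_def)
  then show ?case unfolding finitely_extendable_def by auto
next
  case (Cons c cs)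
  then show ?case using finitely_extendable_append[of "[c]" cs] by simp
qed

text \<open>A loop reappears as the continuation of its body. So the loop \<open>?L\<close> is added
  to \<open>T\<close>, the body is treated over the continuation \<open>?L\<close>, and finally both
  successors of \<open>?L\<close> turn out to be present.\<close>

lemma finitely_extendable_single: "finitely_extendable [c]"
proof (induction c)
  case (Inc r)
  have "step_extension T (insert (Inc r # K) T)" if "finite T" "K \<in> T" for T K
    by (rule step_extensionI) (use that in auto)
  then show ?case unfolding finitely_extendable_def by fastforce
next
  case (Loop r ds)
  then have ds: "finitely_extendable ds" by (intro finitely_extendable_if_single) auto
  show ?case unfolding finitely_extendable_def
  proof (intro allI ballI impI)
    fix T and K :: "com list" assume T: "finite T" "K \<in> T"
    let ?L = "Loop r ds # K"
    have "finite (insert ?L T)" "?L \<in> insert ?L T" using T by auto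
    then obtain S where S: "step_extension (insert ?L T) S" "ds @ ?L \<in> S"
      using ds unfolding finitely_extendable_def by blast
    have sub: "T \<subseteq> S" "?L \<in> S" using step_extension_subset[OF S(1)] by auto
    have "step_extension T S"
    proof (rule step_extensionI)
      fix c M assume M: "c # M \<in> S" "c # M \<notin> T"
      show "M \<in> S \<and> next_prog c M \<in> S"
      proof (cases "c # M = ?L")
        case True
        then show ?thesis using sub(1) T(2) S(2) by auto
      next
        case False
        then show ?thesis using step_extensionD[OF S(1) M(1)] M(2) by simp
      qed
    qed (use sub(1) step_extension_finite[OF S(1)] in auto)
    moreover have "[Loop r ds] @ K \<in> S" using sub(2) by simp
    ultimately show "\<exists>S. step_extension T S \<and> [Loop r ds] @ K \<in> S" by blast
  qed
qed

lemma finite_step_closed_ex: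
  obtains S where "finite S" "step_closed S" "cs \<in> S" "[] \<in> S"
proof -
  have "finitely_extendable cs"
    by (simp add: finitely_extendable_single finitely_extendable_if_single)
  moreover have "finite {[] :: com list}" "[] \<in> {[]}" by auto
  ultimately obtain S where "step_extension {[]} S" "cs @ [] \<in> S"
    unfolding finitely_extendable_def by blast
  then have ext: "step_extension {[]} S" and "cs \<in> S" by auto
  \<comment> \<open>The only exempt program is \<open>[]\<close>, which has no successor, so
    \<open>S\<close> is closed outright.\<close>
  have "step_closed S"
    using step_extensionD[OF ext] by (simp add: step_closed_def)
  then show thesis
    using that step_extension_finite[OF ext] step_extension_subset[OF ext] \<open>cs \<in> S\<close> by simp
qed

lemma com_steps_simulation:
  assumes "com_step\<^sup>*\<^sup>* (Q, s) (Q', s')" "step_closed S" "Q \<in> S" "godel s N"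
  shows "\<exists>N'. godel s' N' \<and> (rule_step (\<Union> (rules_of ` S)))\<^sup>*\<^sup>* ((0, Q), N, 0) ((0, Q'), N', 0)"
  using assms(1,3,4)
proof (induction arbitrary: N rule: converse_rtranclp_induct2)
  case (step Q1 s1 Q2 s2)
  let ?R = "\<Union> (rules_of ` S)"
  obtain M where M: "godel s2 M" "(rule_step ?R)\<^sup>*\<^sup>* ((0, Q1), N, 0) ((0, Q2), M, 0)"
    using com_step_simulation[OF step.hyps(1), of ?R N] step.prems by blast
  have "Q2 \<in> S"
    using step.hyps(1) step.prems(1) \<open>step_closed S\<close>
    by cases (fastforce simp: step_closed_def)+
  from step.IH[OF this M(1)] M(2) show ?case by (meson rtranclp_trans)
qed auto

definition deterministic :: "('a \<Rightarrow> 'a \<Rightarrow> bool) \<Rightarrow> bool" where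
  "deterministic r \<longleftrightarrow> (\<forall>x y z. r x y \<longrightarrow> r x z \<longrightarrow> y = z)"

text \<open>The input register is cleared at the end, so the final number encodes the output alone.
  Whether the output is 0 becomes whether the fixed configuration \<open>(h, 1, 0)\<close> is
  reached.\<close>

lemma recf_two_counter:
  obtains R q0 and h :: "nat \<times> com list" where "finite R" "deterministic (rule_step R)"
    "\<forall>u v. \<not> rule_step R (h, u) v"
    "\<forall>n y. computes f [n] y \<longrightarrow> (\<exists>N.
      (rule_step R)\<^sup>*\<^sup>* (q0, nth_prime 0 ^ n, 0) (h, N, 0) \<and> (N = 1 \<longleftrightarrow> y = 0))"
proof -
  define P where "P = compile f [0] 1 2 @ clear_reg 0"
  obtain S where S: "finite S" "step_closed S" "P \<in> S" "[] \<in> S"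
    by (rule finite_step_closed_ex)
  let ?R = "\<Union> (rules_of ` S)"
  show thesis
  proof (rule that[of ?R "(0, [])" "(0, P)"])
    show "finite ?R" using S(1) finite_rules_of by blast
    show "deterministic (rule_step ?R)"
      unfolding deterministic_def using rule_step_deterministic by blast
    show "\<forall>u v. \<not> rule_step ?R ((0, []), u) v"
      using rule_source by (fastforce elim: rule_step.cases)
    show "\<forall>n y. computes f [n] y \<longrightarrow> (\<exists>N.
      (rule_step ?R)\<^sup>*\<^sup>* ((0, P), nth_prime 0 ^ n, 0) ((0, []), N, 0) \<and> (N = 1 \<longleftrightarrow> y = 0))"
    proof (intro allI impI)
      fix n y assume comp: "computes f [n] y"
      let ?s = "(\<lambda>_. 0)(0 := n) :: nat \<Rightarrow> nat"
      have "exec (compile f [0] 1 2) ?s (?s(1 := y))"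
        by (rule compile_correctD[OF compile_correct comp]) auto
      moreover have "exec (clear_reg 0) (?s(1 := y)) ((\<lambda>_. 0)(1 := y))"
        by (rule exec_clear_reg) auto
      ultimately have "exec P ?s ((\<lambda>_. 0)(1 := y))"
        unfolding P_def by (rule exec_append)
      then have "com_step\<^sup>*\<^sup>* (P, ?s) ([], (\<lambda>_. 0)(1 := y))"
        unfolding exec_def by (metis append_Nil2)
      from com_steps_simulation[OF this S(2,3) godel_power]
      obtain N where N: "godel ((\<lambda>_. 0)(1 := y)) N"
        "(rule_step ?R)\<^sup>*\<^sup>* ((0, P), nth_prime 0 ^ n, 0) ((0, []), N, 0)" by blast
      moreover have "N = 1 \<longleftrightarrow> y = 0" using godel_zero_iff[OF N(1)] by (auto split: if_splits)
      ultimately show "\<exists>N. (rule_step ?R)\<^sup>*\<^sup>* ((0, P), nth_prime 0 ^ n, 0) ((0, []), N, 0) \<and>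
        (N = 1 \<longleftrightarrow> y = 0)" by blast
    qed
  qed
qed

section \<open>Linear equations encoding machine runs\<close>

definition ad_pow :: "('a \<Rightarrow> 'a \<Rightarrow> 'a) \<Rightarrow> 'a \<Rightarrow> nat \<Rightarrow> 'a \<Rightarrow> 'a" where
  "ad_pow br a n = (\<lambda>u. br a u) ^^ n"

text \<open>Since \<open>[[a, u], v] + [u, [a, v]]\<close> lies in \<open>[a, L]\<close>, the powers of \<open>ad\<^sub>a\<close> move across an outer bracket
  as powers of the right bracketing with \<open>a\<close>, without signs.\<close>

definition rad_pow :: "('a \<Rightarrow> 'a \<Rightarrow> 'a) \<Rightarrow> 'a \<Rightarrow> nat \<Rightarrow> 'a \<Rightarrow> 'a" where
  "rad_pow br a n = (\<lambda>u. br u a) ^^ n"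

lemma ad_pow_Suc: "ad_pow br a (Suc n) u = br a (ad_pow br a n u)"
  by (simp add: ad_pow_def)

lemma rad_pow_Suc: "rad_pow br a (Suc n) u = rad_pow br a n (br u a)"
  by (simp add: rad_pow_def funpow_Suc_right del: funpow.simps)

text \<open>For fixed \<open>k\<close> and \<open>i\<close> this is additive in \<open>v\<close>.
  The unknown \<open>v\<close> stands for a combination of the configurations
  \<open>point k i x y\<close> with \<open>x\<close>, \<open>y\<close> free, which is how one
  variable covers infinitely many transitions.\<close>

fun family :: "('a \<Rightarrow> 'a \<Rightarrow> 'a) \<Rightarrow> 'a \<Rightarrow> 'a \<Rightarrow> 'a \<Rightarrow> kind \<Rightarrow> nat \<Rightarrow> 'a \<Rightarrow> 'a" where
  "family br a b c KX i v = br b (rad_pow br a i v)"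
| "family br a b c KY i v = br (rad_pow br a i v) c"
| "family br a b c ZX i v = br (br (ad_pow br a i b) (br b c)) v"
| "family br a b c ZY i v = br v (br (br b c) (ad_pow br a i c))"

fun config :: "('a \<Rightarrow> 'a \<Rightarrow> 'a) \<Rightarrow> 'a \<Rightarrow> 'a \<Rightarrow> 'a \<Rightarrow> nat \<times> nat \<Rightarrow> 'a" where
  "config br a b c (i, j) = br (ad_pow br a i b) (br (br b c) (ad_pow br a j c))"

text \<open>Only compatibility with brackets is assumed, so this and its analogues apply both to the
  evaluation of terms built with \<open>Bracket\<close> and to the map into matrices.\<close>

lemma ad_pow_hom:
  "(\<And>x y. h (br x y) = br' (h x) (h y)) \<Longrightarrow> h (ad_pow br a n u) = ad_pow br' (h a) n (h u)"
  by (induction n) (simp_all add: ad_pow_def)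

lemma rad_pow_hom:
  "(\<And>x y. h (br x y) = br' (h x) (h y)) \<Longrightarrow> h (rad_pow br a n u) = rad_pow br' (h a) n (h u)"
  by (induction n) (simp_all add: rad_pow_def)

lemma family_hom:
  assumes "\<And>x y. h (br x y) = br' (h x) (h y)"
  shows "h (family br a b c k i v) = family br' (h a) (h b) (h c) k i (h v)"
  by (cases k) (simp_all add: assms ad_pow_hom[of h br br'] rad_pow_hom[of h br br'])

lemma config_hom:
  assumes "\<And>x y. h (br x y) = br' (h x) (h y)"
  shows "h (config br a b c u) = config br' (h a) (h b) (h c) u"
  by (cases u) (simp add: assms ad_pow_hom[of h br br'])

context lie_algebra
begin

lemma bracket_zero: "bracket 0 x = 0" "bracket x 0 = 0"
  using bracket_add_left[of 0 0 x] bracket_add_right[of x 0 0] by simp_all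

lemma bracket_swap: "bracket x y = - bracket y x"
proof -
  have "bracket x y + bracket y x = 0"
    using bracket_self[of "x + y"] unfolding bracket_add_left bracket_add_right
    by (simp add: bracket_self add.commute)
  then show ?thesis by (simp only: eq_neg_iff_add_eq_0)
qed

lemma bracket_minus: "bracket (- x) y = - bracket x y" "bracket x (- y) = - bracket x y"
  using bracket_add_left[of x "- x" y] bracket_add_right[of x y "- y"]
  by (simp_all add: bracket_zero eq_neg_iff_add_eq_0 add.commute)

lemma bracket_bracket_left:
  "bracket (bracket x y) z = bracket x (bracket y z) - bracket y (bracket x z)"
proof -
  have "bracket (bracket x y) z = bracket x (bracket y z) + bracket y (bracket z x)"
    using jacobi[of x y z] by (subst bracket_swap) (simp add: neg_eq_iff_add_eq_0 add.commute)
  then show ?thesis using bracket_swap[of z x] by (simp add: bracket_minus)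
qed

lemma rad_pow_add: "rad_pow bracket a n (u + v) = rad_pow bracket a n u + rad_pow bracket a n v"
  by (induction n) (simp_all add: rad_pow_def bracket_add_left)

lemma family_add:
  "family bracket a b c k i (u + v) = family bracket a b c k i u + family bracket a b c k i v"
  by (cases k) (simp_all add: rad_pow_add bracket_add_left bracket_add_right)

lemma family_zero: "family bracket a b c k i 0 = 0"
  using family_add[of a b c k i 0 0] by simp

section \<open>Calculation modulo [a, L] + [[b, c], L]\<close>

definition residual :: "'l \<Rightarrow> 'l \<Rightarrow> 'l \<Rightarrow> 'l \<Rightarrow> bool" where
  "residual a b c x \<longleftrightarrow> (\<exists>z z'. x = bracket a z + bracket (bracket b c) z')"

lemma residual_0: "residual a b c 0"
  unfolding residual_def by (rule exI[of _ 0], rule exI[of _ 0]) (simp add: bracket_zero)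

lemma residual_left: "residual a b c (bracket a z)"
  unfolding residual_def by (rule exI[of _ z], rule exI[of _ 0]) (simp add: bracket_zero)

lemma residual_right: "residual a b c (bracket (bracket b c) z)"
  unfolding residual_def by (rule exI[of _ 0], rule exI[of _ z]) (simp add: bracket_zero)

lemma residual_add: "residual a b c x \<Longrightarrow> residual a b c y \<Longrightarrow> residual a b c (x + y)"
proof -
  assume "residual a b c x" "residual a b c y"
  then obtain z z' w w' where "x = bracket a z + bracket (bracket b c) z'"
    "y = bracket a w + bracket (bracket b c) w'"
    unfolding residual_def by blast
  then have "x + y = bracket a (z + w) + bracket (bracket b c) (z' + w')"
    by (simp add: bracket_add_right)
  then show ?thesis unfolding residual_def by blast
qed

lemma residual_minus: "residual a b c x \<Longrightarrow> residual a b c (- x)"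
  unfolding residual_def by (metis bracket_minus(2) minus_add_distrib)

lemma residual_diff: "residual a b c x \<Longrightarrow> residual a b c y \<Longrightarrow> residual a b c (x - y)"
  using residual_add residual_minus by fastforce

lemma residual_diff_trans:
  "residual a b c (x - y) \<Longrightarrow> residual a b c (y - z) \<Longrightarrow> residual a b c (x - z)"
  using residual_add by fastforce

text \<open>By Jacobi, [u, [w, a]] and [[a, u], w] differ by - [a, [u, w]]; this moves one power
  across, and the induction generalises \<open>w\<close>.\<close>

lemma residual_rad_right:
  "residual a b c (bracket u (rad_pow bracket a n w) - bracket (ad_pow bracket a n u) w)"
proof (induction n arbitrary: w)
  case 0
  show ?case by (simp add: rad_pow_def ad_pow_def residual_0)
next
  case (Suc n)
  let ?u = "ad_pow bracket a n u"
  have "bracket ?u (bracket w a) - bracket (bracket a ?u) w = - bracket a (bracket ?u w)"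
    by (subst bracket_swap[of w a]) (simp add: bracket_minus bracket_bracket_left)
  then have "residual a b c (bracket ?u (bracket w a) - bracket (bracket a ?u) w)"
    by (simp add: residual_left residual_minus)
  from residual_diff_trans[OF Suc.IH this] show ?case
    by (simp only: rad_pow_Suc ad_pow_Suc)
qed

lemma residual_rad_left:
  "residual a b c (bracket (rad_pow bracket a n w) u - bracket w (ad_pow bracket a n u))"
proof (induction n arbitrary: w)
  case 0
  show ?case by (simp add: rad_pow_def ad_pow_def residual_0)
next
  case (Suc n)
  let ?u = "ad_pow bracket a n u"
  have "bracket (bracket w a) ?u - bracket w (bracket a ?u) = - bracket a (bracket w ?u)"
    by (simp add: bracket_bracket_left)
  then have "residual a b c (bracket (bracket w a) ?u - bracket w (bracket a ?u))"
    by (simp add: residual_left residual_minus)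
  from residual_diff_trans[OF Suc.IH this] show ?case
    by (simp only: rad_pow_Suc ad_pow_Suc)
qed

text \<open>With d = [b, c], Jacobi gives the difference - [d, [u, v]]. This is what the summand
  [d, L] is for.\<close>

lemma residual_middle:
  "residual a b c (bracket (bracket u (bracket b c)) v - bracket u (bracket (bracket b c) v))"
  by (simp add: bracket_bracket_left[of u] residual_right residual_minus)

text \<open>The order of quantifiers is essential: one \<open>v\<close> serves all \<open>i\<close>,
  so the same unknown describes the source and the target of a rule.\<close>

lemma family_point:
  "\<exists>v. \<forall>i. residual a b c (family bracket a b c k i v - config bracket a b c (point k i x y))"
proof -
  let ?b = "\<lambda>i. ad_pow bracket a i b" and ?c = "\<lambda>j. ad_pow bracket a j c" and ?d = "bracket b c"
  show ?thesis
  proof (cases k)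
    case KX
    have "residual a b c (family bracket a b c k i (rad_pow bracket a x (bracket ?d (?c y)))
        - config bracket a b c (point k i x y))" for i
      using residual_rad_right[of a b c b "x + i" "bracket ?d (?c y)"] KX
      by (simp add: rad_pow_def funpow_add add.commute[of x])
    then show ?thesis by blast
  next
    case KY
    have "residual a b c (family bracket a b c k i (rad_pow bracket a y (bracket (?b x) ?d))
        - config bracket a b c (point k i x y))" for i
      using residual_diff_trans[OF residual_rad_left residual_middle,
          of a b c "y + i" "?b x" c] KY
      by (simp add: rad_pow_def funpow_add add.commute[of y])
    then show ?thesis by blast
  next
    case ZX
    then have "residual a b c (family bracket a b c k i (?c y) - config bracket a b c (point k i x y))" for i
      by (simp add: residual_middle)
    then show ?thesis by blast
  next
    case ZY
    then have "residual a b c (family bracket a b c k i (?b x) - config bracket a b c (point k i x y))" for i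
      by (simp add: residual_0)
    then show ?thesis by blast
  qed
qed

section \<open>Flows along the rules\<close>

definition outflow :: "'l \<Rightarrow> 'l \<Rightarrow> 'l \<Rightarrow> 'q rule set \<Rightarrow> ('q rule \<Rightarrow> 'l) \<Rightarrow> 'q \<Rightarrow> 'l" where
  "outflow a b c R V q =
    (\<Sum>r\<in>R. case r of (k, q1, i, q2, j) \<Rightarrow> if q1 = q then family bracket a b c k i (V r) else 0)"

definition inflow :: "'l \<Rightarrow> 'l \<Rightarrow> 'l \<Rightarrow> 'q rule set \<Rightarrow> ('q rule \<Rightarrow> 'l) \<Rightarrow> 'q \<Rightarrow> 'l" where
  "inflow a b c R V q =
    (\<Sum>r\<in>R. case r of (k, q1, i, q2, j) \<Rightarrow> if q2 = q then family bracket a b c k j (V r) else 0)"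

definition placed :: "'l \<Rightarrow> 'l \<Rightarrow> 'l \<Rightarrow> 'q \<times> nat \<times> nat \<Rightarrow> 'q \<Rightarrow> 'l" where
  "placed a b c u q = (if q = fst u then config bracket a b c (snd u) else 0)"

text \<open>Conservation at every state, modulo residuals. Since \<open>family\<close> is additive
  in the unknown, flows of consecutive runs add up and the middle configuration cancels.\<close>

definition linked :: "'l \<Rightarrow> 'l \<Rightarrow> 'l \<Rightarrow> 'q rule set \<Rightarrow> 'q \<times> nat \<times> nat \<Rightarrow> 'q \<times> nat \<times> nat \<Rightarrow> bool" where
  "linked a b c R u u' \<longleftrightarrow> (\<exists>V. \<forall>q. residual a b c
    ((inflow a b c R V q + placed a b c u q) - (outflow a b c R V q + placed a b c u' q)))"

lemma outflow_add: "outflow a b c R (\<lambda>r. V r + W r) q = outflow a b c R V q + outflow a b c R W q"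
  unfolding outflow_def sum.distrib[symmetric]
  by (rule sum.cong) (auto simp: family_add)

lemma inflow_add: "inflow a b c R (\<lambda>r. V r + W r) q = inflow a b c R V q + inflow a b c R W q"
  unfolding inflow_def sum.distrib[symmetric]
  by (rule sum.cong) (auto simp: family_add)

lemma linked_refl: "linked a b c R u u"
proof -
  have "inflow a b c R (\<lambda>_. 0) q = 0" "outflow a b c R (\<lambda>_. 0) q = 0" for q
    by (auto simp: inflow_def outflow_def family_zero intro!: sum.neutral)
  then show ?thesis unfolding linked_def by (intro exI[of _ "\<lambda>_. 0"]) (simp add: residual_0)
qed

lemma linked_trans:
  assumes "linked a b c R u v" "linked a b c R v w"
  shows "linked a b c R u w"
proof -
  obtain V W where
    V: "\<And>q. residual a b c
      ((inflow a b c R V q + placed a b c u q) - (outflow a b c R V q + placed a b c v q))"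
    and W: "\<And>q. residual a b c
      ((inflow a b c R W q + placed a b c v q) - (outflow a b c R W q + placed a b c w q))"
    using assms unfolding linked_def by blast
  have "residual a b c ((inflow a b c R (\<lambda>r. V r + W r) q + placed a b c u q)
      - (outflow a b c R (\<lambda>r. V r + W r) q + placed a b c w q))" for q
    using residual_add[OF V[of q] W[of q]] by (simp add: inflow_add outflow_add algebra_simps)
  then show ?thesis unfolding linked_def by blast
qed

lemma linked_step:
  assumes "finite R" "rule_step R u u'"
  shows "linked a b c R u u'"
  using assms(2)
proof cases
  case (1 k q1 i q2 j x y)
  obtain v where v: "\<And>i. residual a b c (family bracket a b c k i v - config bracket a b c (point k i x y))"
    using family_point by blast
  let ?r = "(k, q1, i, q2, j)"
  \<comment> \<open>A single step uses the flow supported on its own rule.\<close>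
  let ?V = "\<lambda>r. if r = ?r then v else 0"
  have out: "outflow a b c R ?V q = (if q = q1 then family bracket a b c k i v else 0)" for q
  proof -
    have "outflow a b c R ?V q =
        (\<Sum>r\<in>R. if r = ?r then (if q = q1 then family bracket a b c k i v else 0) else 0)"
      unfolding outflow_def
    proof (rule sum.cong)
      fix r show "(case r of (k, q1, i, q2, j) \<Rightarrow> if q1 = q then family bracket a b c k i (?V r) else 0) =
          (if r = ?r then (if q = q1 then family bracket a b c k i v else 0) else 0)"
        by (cases "r = ?r") (auto simp: family_zero split: prod.split)
    qed simp
    then show ?thesis using assms(1) 1 by simp
  qed
  have inn: "inflow a b c R ?V q = (if q = q2 then family bracket a b c k j v else 0)" for q
  proof -
    have "inflow a b c R ?V q =
        (\<Sum>r\<in>R. if r = ?r then (if q = q2 then family bracket a b c k j v else 0) else 0)"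
      unfolding inflow_def
    proof (rule sum.cong)
      fix r show "(case r of (k, q1, i, q2, j) \<Rightarrow> if q2 = q then family bracket a b c k j (?V r) else 0) =
          (if r = ?r then (if q = q2 then family bracket a b c k j v else 0) else 0)"
        by (cases "r = ?r") (auto simp: family_zero split: prod.split)
    qed simp
    then show ?thesis using assms(1) 1 by simp
  qed
  have "residual a b c
      ((inflow a b c R ?V q + placed a b c u q) - (outflow a b c R ?V q + placed a b c u' q))" for q
  proof -
    let ?f = "\<lambda>i. family bracket a b c k i v - config bracket a b c (point k i x y)"
    have "(inflow a b c R ?V q + placed a b c u q) - (outflow a b c R ?V q + placed a b c u' q) =
        (if q = q2 then ?f j else 0) - (if q = q1 then ?f i else 0)"
      using 1 by (simp add: out inn placed_def)
    moreover have "residual a b c (if P then ?f i else 0)" for P i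
      using v residual_0 by simp
    ultimately show ?thesis by (simp only: residual_diff)
  qed
  then show ?thesis unfolding linked_def by blast
qed

lemma linked_steps: "(rule_step R)\<^sup>*\<^sup>* u v \<Longrightarrow> finite R \<Longrightarrow> linked a b c R u v"
  by (induction rule: rtranclp_induct) (auto intro: linked_refl linked_trans linked_step)

text \<open>The residual witnesses become unknowns \<open>Z\<close> and \<open>Z'\<close>, and
  subtractions are moved to the other side, so that each condition is an equality of Lie
  terms.\<close>

definition flow_solvable ::
  "'l \<Rightarrow> 'l \<Rightarrow> 'l \<Rightarrow> 'q rule set \<Rightarrow> 'q set \<Rightarrow> 'q \<times> nat \<times> nat \<Rightarrow> 'q \<times> nat \<times> nat \<Rightarrow> bool" where
  "flow_solvable a b c R Q u u' \<longleftrightarrow> (\<exists>V Z Z'. \<forall>q\<in>Q.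
    outflow a b c R V q + (bracket a (Z q) + bracket (bracket b c) (Z' q)) + placed a b c u' q =
    inflow a b c R V q + placed a b c u q)"

lemma flow_solvable_if_linked:
  assumes "linked a b c R u u'"
  shows "flow_solvable a b c R Q u u'"
proof -
  obtain V where "\<forall>q. \<exists>z z'.
      (inflow a b c R V q + placed a b c u q) - (outflow a b c R V q + placed a b c u' q) =
      bracket a z + bracket (bracket b c) z'"
    using assms unfolding linked_def residual_def by blast
  then obtain Z Z' where "\<And>q.
      (inflow a b c R V q + placed a b c u q) - (outflow a b c R V q + placed a b c u' q) =
      bracket a (Z q) + bracket (bracket b c) (Z' q)"
    by metis
  then show ?thesis unfolding flow_solvable_def
    by (intro exI[of _ V] exI[of _ Z] exI[of _ Z']) (simp add: diff_eq_eq algebra_simps)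
qed

end

section \<open>A matrix Lie algebra\<close>

text \<open>The linear functional with value \<open>g (m, n)\<close> on X^m Y^n; the inner variable
  is X and the outer one is Y.\<close>

definition coeff_sum :: "(nat \<times> nat \<Rightarrow> 'k) \<Rightarrow> 'k::comm_ring_1 poly poly \<Rightarrow> 'k" where
  "coeff_sum g p = (\<Sum>n\<le>degree p. \<Sum>m\<le>degree (coeff p n). coeff (coeff p n) m * g (m, n))"

lemma coeff_sum_bound:
  assumes "degree p \<le> N" "\<And>n. degree (coeff p n) \<le> M"
  shows "coeff_sum g p = (\<Sum>n\<le>N. \<Sum>m\<le>M. coeff (coeff p n) m * g (m, n))"
proof -
  have inner: "(\<Sum>m\<le>degree (coeff p n). coeff (coeff p n) m * g (m, n)) =
      (\<Sum>m\<le>M. coeff (coeff p n) m * g (m, n))" for n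
    using assms(2)[of n] by (intro sum.mono_neutral_left) (auto simp: coeff_eq_0)
  show ?thesis unfolding coeff_sum_def inner
    using assms(1) by (intro sum.mono_neutral_left) (auto simp: coeff_eq_0)
qed

lemma coeff_degree_bound:
  obtains M where "\<And>n. degree (coeff p n) \<le> M"
proof
  fix n
  show "degree (coeff p n) \<le> (\<Sum>n\<le>degree p. degree (coeff p n))"
    by (cases "n \<le> degree p") (auto intro: member_le_sum simp: coeff_eq_0)
qed

lemma coeff_sum_add: "coeff_sum g (p + q) = coeff_sum g p + coeff_sum g q"
proof -
  obtain M M' where M: "\<And>n. degree (coeff p n) \<le> M" and M': "\<And>n. degree (coeff q n) \<le> M'"
    using coeff_degree_bound by metis
  let ?N = "max (degree p) (degree q)" and ?M = "max M M'"
  have p: "degree (coeff p n) \<le> ?M" and q: "degree (coeff q n) \<le> ?M" for n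
    using M[of n] M'[of n] by auto
  then have "degree (coeff (p + q) n) \<le> ?M" for n
    unfolding coeff_add by (intro degree_add_le)
  then show ?thesis
    using p q
    by (subst (1 2 3) coeff_sum_bound[of _ ?N ?M])
      (auto simp: degree_add_le algebra_simps sum.distrib)
qed

lemma coeff_sum_0: "coeff_sum g 0 = 0"
  by (simp add: coeff_sum_def)

abbreviation (input) poly_X :: "'k::comm_ring_1 poly poly" where
  "poly_X \<equiv> [:[:0, 1:]:]"

abbreviation (input) poly_Y :: "'k::comm_ring_1 poly poly" where
  "poly_Y \<equiv> [:0, 1:]"

text \<open>Multiplication by X shifts the coefficients, which is dual to shifting the argument of
  \<open>g\<close>.\<close>

lemma coeff_sum_mult_X: "coeff_sum g (poly_X * p) = coeff_sum (\<lambda>(m, n). g (Suc m, n)) p"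
proof -
  obtain M where M: "\<And>n. degree (coeff p n) \<le> M" using coeff_degree_bound by blast
  have eq: "coeff (poly_X * p) n = pCons 0 (coeff p n)" for n by simp
  have deg: "degree (coeff (poly_X * p) n) \<le> Suc M" for n
    unfolding eq using M[of n] by (simp add: degree_pCons_le le_trans[OF degree_pCons_le])
  have "degree (poly_X * p) \<le> degree p" by (simp add: degree_smult_le)
  then have "coeff_sum g (poly_X * p) =
      (\<Sum>n\<le>degree p. \<Sum>m\<le>Suc M. coeff (pCons 0 (coeff p n)) m * g (m, n))"
    by (subst coeff_sum_bound[OF _ deg]) (simp_all add: eq del: mult_pCons_left)
  also have "\<dots> = coeff_sum (\<lambda>(m, n). g (Suc m, n)) p"
    by (subst coeff_sum_bound[OF order.refl M]) (simp add: sum.atMost_Suc_shift del: sum.atMost_Suc)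
  finally show ?thesis .
qed

lemma coeff_sum_mult_Y: "coeff_sum g (poly_Y * p) = coeff_sum (\<lambda>(m, n). g (m, Suc n)) p"
proof -
  obtain M where M: "\<And>n. degree (coeff p n) \<le> M" using coeff_degree_bound by blast
  have eq: "poly_Y * p = pCons 0 p" by simp
  have deg: "degree (coeff (pCons 0 p) n) \<le> M" for n
    using M by (cases n) auto
  have "coeff_sum g (pCons 0 p) =
      (\<Sum>n\<le>Suc (degree p). \<Sum>m\<le>M. coeff (coeff (pCons 0 p) n) m * g (m, n))"
    by (rule coeff_sum_bound[OF degree_pCons_le deg])
  also have "\<dots> = coeff_sum (\<lambda>(m, n). g (m, Suc n)) p"
    by (subst coeff_sum_bound[OF order.refl M]) (simp add: sum.atMost_Suc_shift del: sum.atMost_Suc)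
  finally show ?thesis unfolding eq .
qed

lemma coeff_sum_mult_X_power:
  "coeff_sum g (poly_X ^ i * p) = coeff_sum (\<lambda>(m, n). g (m + i, n)) p"
proof (induction i arbitrary: g)
  case (Suc i)
  show ?case
    unfolding power_Suc mult.assoc coeff_sum_mult_X Suc.IH by (simp add: case_prod_unfold)
qed simp

lemma coeff_sum_mult_Y_power:
  "coeff_sum g (poly_Y ^ i * p) = coeff_sum (\<lambda>(m, n). g (m, n + i)) p"
proof (induction i arbitrary: g)
  case (Suc i)
  show ?case
    unfolding power_Suc mult.assoc coeff_sum_mult_Y Suc.IH by (simp add: case_prod_unfold)
qed simp

lemma coeff_sum_monomial: "coeff_sum g (poly_X ^ i * poly_Y ^ j) = g (i, j)"
proof -
  have one: "coeff_sum h 1 = h (0, 0)" for h :: "nat \<times> nat \<Rightarrow> 'a"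
    by (simp add: coeff_sum_def)
  show ?thesis
    using coeff_sum_mult_Y_power[of "\<lambda>(m, n). g (m + i, n)" j 1]
    by (simp only: coeff_sum_mult_X_power one mult_1_right prod.case add_0)
qed

definition X_only :: "'k::comm_ring_1 poly poly \<Rightarrow> bool" where
  "X_only p \<longleftrightarrow> degree p = 0"

definition Y_only :: "'k::comm_ring_1 poly poly \<Rightarrow> bool" where
  "Y_only p \<longleftrightarrow> (\<forall>n. degree (coeff p n) = 0)"

text \<open>Used for the kind \<open>ZY\<close>: a polynomial without Y tests \<open>g\<close> only
  where the second counter is 0.\<close>

lemma coeff_sum_X_only:
  "X_only p \<Longrightarrow> (\<And>m. g (m, 0) = g' (m, 0)) \<Longrightarrow> coeff_sum g p = coeff_sum g' p"
  by (simp add: X_only_def coeff_sum_def)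

lemma coeff_sum_Y_only:
  "Y_only p \<Longrightarrow> (\<And>n. g (0, n) = g' (0, n)) \<Longrightarrow> coeff_sum g p = coeff_sum g' p"
  by (simp add: Y_only_def coeff_sum_def)

lemma X_only_add: "X_only p \<Longrightarrow> X_only q \<Longrightarrow> X_only (p + q)"
  unfolding X_only_def using degree_add_le[of p 0 q] by simp

lemma X_only_diff: "X_only p \<Longrightarrow> X_only q \<Longrightarrow> X_only (p - q)"
  unfolding X_only_def using degree_diff_le[of p 0 q] by simp

lemma X_only_mult: "X_only p \<Longrightarrow> X_only q \<Longrightarrow> X_only (p * q)"
  unfolding X_only_def using degree_mult_le[of p q] by simp

lemma Y_only_add: "Y_only p \<Longrightarrow> Y_only q \<Longrightarrow> Y_only (p + q)"
  unfolding Y_only_def by (metis coeff_add degree_add_le le_zero_eq order.refl)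

lemma Y_only_diff: "Y_only p \<Longrightarrow> Y_only q \<Longrightarrow> Y_only (p - q)"
  unfolding Y_only_def by (metis coeff_diff degree_diff_le le_zero_eq order.refl)

lemma Y_only_mult:
  assumes "Y_only p" "Y_only q"
  shows "Y_only (p * q)"
proof -
  have "degree (coeff p i * coeff q j) \<le> 0" for i j
    using degree_mult_le[of "coeff p i" "coeff q j"] assms by (simp add: Y_only_def)
  then have "degree (\<Sum>i\<le>n. coeff p i * coeff q (n - i)) \<le> 0" for n
    by (intro degree_sum_le) auto
  then show ?thesis by (simp add: Y_only_def coeff_mult)
qed

section \<open>Matrices over K[X, Y]\<close>

type_synonym 'k matrix = "nat \<Rightarrow> nat \<Rightarrow> 'k poly poly"

text \<open>Only the summation index is bounded by 5. The product is therefore associative on the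
  whole function type, and no carrier set is needed; the entries with indices below 5 multiply as 5
  x 5 matrices.\<close>

definition mat_mult :: "'k::field matrix \<Rightarrow> 'k matrix \<Rightarrow> 'k matrix" where
  "mat_mult M N = (\<lambda>i j. \<Sum>l<5. M i l * N l j)"

definition mat_bracket :: "'k::field matrix \<Rightarrow> 'k matrix \<Rightarrow> 'k matrix" where
  "mat_bracket M N = mat_mult M N - mat_mult N M"

definition mat_scale :: "'k::field \<Rightarrow> 'k matrix \<Rightarrow> 'k matrix" where
  "mat_scale c M = (\<lambda>i j. smult [:c:] (M i j))"

lemma mat_mult_assoc: "mat_mult (mat_mult M N) K = mat_mult M (mat_mult N K)"
  unfolding mat_mult_def sum_distrib_left sum_distrib_right
  by (subst sum.swap) (simp add: mult.assoc)

lemma mat_mult_add: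
  "mat_mult (M + N) K = mat_mult M K + mat_mult N K" "mat_mult K (M + N) = mat_mult K M + mat_mult K N"
  by (simp_all add: mat_mult_def fun_eq_iff algebra_simps sum.distrib)

lemma mat_mult_diff:
  "mat_mult (M - N) K = mat_mult M K - mat_mult N K" "mat_mult K (M - N) = mat_mult K M - mat_mult K N"
  by (simp_all add: mat_mult_def fun_eq_iff algebra_simps sum_subtractf)

lemma mat_mult_scale:
  fixes M N :: "'a::field matrix"
  shows "mat_mult (mat_scale c M) N = mat_scale c (mat_mult M N)"
  "mat_mult M (mat_scale c N) = mat_scale c (mat_mult M N)"
proof -
  have "smult d (\<Sum>l<5. f l) = (\<Sum>l<5. smult d (f l))" for d and f :: "nat \<Rightarrow> 'a poly poly"
    using sum_distrib_left[of "[:d:]" f "{..<5}"] by simp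
  then show "mat_mult (mat_scale c M) N = mat_scale c (mat_mult M N)"
    "mat_mult M (mat_scale c N) = mat_scale c (mat_mult M N)"
    by (simp_all add: mat_mult_def mat_scale_def fun_eq_iff)
qed

lemma lie_algebra_matrix: "lie_algebra mat_scale mat_bracket"
proof
  fix a b :: 'a and x y z :: "'a matrix"
  show "mat_scale a (x + y) = mat_scale a x + mat_scale a y"
    by (simp add: mat_scale_def fun_eq_iff smult_add_right)
  show "mat_scale (a + b) x = mat_scale a x + mat_scale b x"
    by (simp add: mat_scale_def fun_eq_iff smult_add_left[symmetric])
  show "mat_scale a (mat_scale b x) = mat_scale (a * b) x"
    by (simp add: mat_scale_def fun_eq_iff mult.commute)
  show "mat_scale 1 x = x"
    by (simp add: mat_scale_def fun_eq_iff one_pCons[symmetric])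
  show "mat_bracket (x + y) z = mat_bracket x z + mat_bracket y z"
    "mat_bracket x (y + z) = mat_bracket x y + mat_bracket x z"
    by (simp_all add: mat_bracket_def mat_mult_add)
  have scale_diff: "mat_scale a (x - y) = mat_scale a x - mat_scale a y" for x y
    by (simp add: mat_scale_def fun_eq_iff smult_diff_right)
  show "mat_bracket (mat_scale a x) y = mat_scale a (mat_bracket x y)"
    "mat_bracket x (mat_scale a y) = mat_scale a (mat_bracket x y)"
    by (simp_all add: mat_bracket_def mat_mult_scale scale_diff)
  show "mat_bracket x x = 0"
    by (simp add: mat_bracket_def)
  show "mat_bracket x (mat_bracket y z) + mat_bracket y (mat_bracket z x) +
      mat_bracket z (mat_bracket x y) = 0"
    by (simp add: mat_bracket_def mat_mult_diff mat_mult_assoc)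
qed

text \<open>The differences of these weights turn bracketing with \<open>a\<close> into multiplication by \<open>X\<close> at the
  positions \<open>(0, 1)\<close> and \<open>(1, 4)\<close>, by \<open>Y\<close> at \<open>(3, 4)\<close> and \<open>(0, 3)\<close>, and by \<open>0\<close> at the corner \<open>(0, 4)\<close>.\<close>

definition weight :: "nat \<Rightarrow> 'k::field poly poly" where
  "weight i = (if i = 1 then - poly_X else if i = 3 then poly_Y else 0)"

definition mat_a :: "'k::field matrix" where
  "mat_a i j = (if i = j then weight i else 0)"

definition mat_b :: "'k::field matrix" where
  "mat_b i j = (if (i, j) \<in> {(0, 1), (1, 2)} then 1 else 0)"

definition mat_c :: "'k::field matrix" where
  "mat_c i j = (if (i, j) \<in> {(2, 3), (3, 4)} then 1 else 0)"

lemma mat_mult_a: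
  assumes "i < 5" "j < 5"
  shows "mat_mult mat_a M i j = weight i * M i j" "mat_mult M mat_a i j = M i j * weight j"
proof -
  have "mat_mult mat_a M i j = (\<Sum>l<5. if l = i then weight i * M i j else 0)"
    unfolding mat_mult_def by (rule sum.cong) (auto simp: mat_a_def)
  then show "mat_mult mat_a M i j = weight i * M i j" using assms by simp
  have "mat_mult M mat_a i j = (\<Sum>l<5. if l = j then M i j * weight j else 0)"
    unfolding mat_mult_def by (rule sum.cong) (auto simp: mat_a_def)
  then show "mat_mult M mat_a i j = M i j * weight j" using assms by simp
qed

lemma ad_pow_mat_a:
  "i < 5 \<Longrightarrow> j < 5 \<Longrightarrow> ad_pow mat_bracket mat_a n M i j = (weight i - weight j) ^ n * M i j"
  by (induction n) (simp_all add: ad_pow_def mat_bracket_def mat_mult_a algebra_simps)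

lemma rad_pow_mat_a:
  "i < 5 \<Longrightarrow> j < 5 \<Longrightarrow> rad_pow mat_bracket mat_a n M i j = (weight j - weight i) ^ n * M i j"
  by (induction n) (simp_all add: rad_pow_def mat_bracket_def mat_mult_a algebra_simps)

lemmas sum_5 = lessThan_nat_numeral lessThan_Suc

text \<open>Of all products of the matrix units in b and c only E_12 E_23 = E_13 survives.\<close>

lemma mat_bracket_b_c: "mat_bracket mat_b mat_c i j = (if (i, j) = (1, 3) then 1 else 0)"
  by (auto simp: mat_bracket_def mat_mult_def mat_b_def mat_c_def sum_5)

text \<open>The weights 0 and 4 coincide, and E_13 meets neither row 0 nor column 4.\<close>

lemma mat_bracket_corner_zero:
  "mat_bracket mat_a M 0 4 = 0" "mat_bracket (mat_bracket mat_b mat_c) M 0 4 = 0"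
  by (simp_all add: mat_bracket_def[of _ M] mat_mult_a weight_def)
    (simp add: mat_mult_def mat_bracket_b_c)

text \<open>A Lie subalgebra containing the three generator matrices. The conditions at (0, 1) and
  (3, 4) make the pinned counter visible in the kinds \<open>ZY\<close> and \<open>ZX\<close>; the
  diagonal conditions make them stable under brackets.\<close>

definition restricted :: "'k::field matrix \<Rightarrow> bool" where
  "restricted M \<longleftrightarrow> (\<forall>i<5. \<forall>j<i. M i j = 0) \<and> M 0 0 = 0 \<and> M 4 4 = 0 \<and>
    X_only (M 1 1) \<and> Y_only (M 3 3) \<and> X_only (M 0 1) \<and> Y_only (M 3 4)"

lemma restricted_0: "restricted 0"
  by (simp add: restricted_def X_only_def Y_only_def)

lemma restricted_add: "restricted M \<Longrightarrow> restricted N \<Longrightarrow> restricted (M + N)"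
  by (simp add: restricted_def X_only_add Y_only_add)

lemma X_only_smult: "X_only p \<Longrightarrow> X_only (smult [:c:] p)"
  using X_only_mult[of "[:[:c:]:]" p] by (simp add: X_only_def)

lemma Y_only_smult: "Y_only p \<Longrightarrow> Y_only (smult [:c:] p)"
proof -
  assume "Y_only p"
  then have "degree ([:c:] * coeff p n) \<le> 0" for n
    using degree_mult_le[of "[:c:]" "coeff p n"] by (simp add: Y_only_def)
  then show ?thesis by (simp add: Y_only_def)
qed

lemma restricted_scale: "restricted M \<Longrightarrow> restricted (mat_scale c M)"
  by (simp add: restricted_def mat_scale_def X_only_smult Y_only_smult)

lemma mat_mult_triangular:
  assumes "\<forall>i<5. \<forall>j<i. M i j = 0" "\<forall>i<5. \<forall>j<i. N i j = 0" "i < 5" "j < 5"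
  shows "mat_mult M N i j = (\<Sum>l\<in>{i..j}. M i l * N l j)"
  unfolding mat_mult_def
  by (rule sum.mono_neutral_right) (use assms in \<open>auto simp: not_le\<close>)

text \<open>By triangularity the entries (0, 1) and (3, 4) of a product involve only those positions
  and the adjacent diagonal ones, and a commutator has zero diagonal.\<close>

lemma restricted_bracket:
  assumes M: "restricted M" and N: "restricted N"
  shows "restricted (mat_bracket M N)"
proof -
  have tri: "\<forall>i<5. \<forall>j<i. M i j = 0" "\<forall>i<5. \<forall>j<i. N i j = 0"
    using M N by (simp_all add: restricted_def)
  have entry: "mat_bracket M N i j = (\<Sum>l\<in>{i..j}. M i l * N l j) - (\<Sum>l\<in>{i..j}. N i l * M l j)"
    if "i < 5" "j < 5" for i j
    unfolding mat_bracket_def using mat_mult_triangular[OF tri that] mat_mult_triangular[OF tri(2,1) that]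
    by simp
  have upto: "{0..1::nat} = {0, 1}" "{3..4::nat} = {3, 4}" by auto
  have "mat_bracket M N i i = 0" if "i < 5" for i
    using entry[OF that that] by (simp add: mult.commute)
  moreover have "X_only (mat_bracket M N 0 1)" "Y_only (mat_bracket M N 3 4)"
    using M N unfolding restricted_def
    by (simp_all add: entry upto X_only_mult X_only_add X_only_diff Y_only_mult Y_only_add Y_only_diff)
  ultimately show ?thesis
    using entry by (simp add: restricted_def X_only_def Y_only_def)
qed

lemma restricted_generators: "restricted mat_a" "restricted mat_b" "restricted mat_c"
  by (auto simp: restricted_def X_only_def Y_only_def mat_a_def mat_b_def mat_c_def weight_def
      coeff_pCons split: nat.split)

lemma ad_pow_mat_b: "i < 5 \<Longrightarrow> ad_pow mat_bracket mat_a n mat_b 0 i = (if i = 1 then poly_X ^ n else 0)"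
  by (simp add: ad_pow_mat_a) (simp add: weight_def mat_b_def)

lemma ad_pow_mat_c: "i < 5 \<Longrightarrow> ad_pow mat_bracket mat_a n mat_c i 4 = (if i = 3 then poly_Y ^ n else 0)"
  by (simp add: ad_pow_mat_a) (simp add: weight_def mat_c_def)

lemma ad_pow_mat_b_3_4: "ad_pow mat_bracket mat_a n mat_b 3 4 = 0"
  by (simp add: ad_pow_mat_a) (simp add: mat_b_def)

lemma ad_pow_mat_c_0_1: "ad_pow mat_bracket mat_a n mat_c 0 (Suc 0) = 0"
  by (simp add: ad_pow_mat_a) (simp add: mat_c_def)

lemma mat_bracket_family_left:
  assumes "i < 5"
  shows "mat_bracket (ad_pow mat_bracket mat_a n mat_b) (mat_bracket mat_b mat_c) 0 i =
      (if i = 3 then poly_X ^ n else 0)"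
  by (simp add: mat_bracket_def[of "ad_pow _ _ _ _"] mat_mult_def mat_bracket_b_c sum_5 ad_pow_mat_b)

lemma mat_bracket_family_left_4:
  assumes "i < 5"
  shows "mat_bracket (ad_pow mat_bracket mat_a n mat_b) (mat_bracket mat_b mat_c) i 4 = 0"
  by (simp add: mat_bracket_def[of "ad_pow _ _ _ _"] mat_mult_def mat_bracket_b_c sum_5
      ad_pow_mat_b_3_4)

lemma mat_bracket_family_right:
  assumes "i < 5"
  shows "mat_bracket (mat_bracket mat_b mat_c) (ad_pow mat_bracket mat_a n mat_c) i 4 =
      (if i = 1 then poly_Y ^ n else 0)"
  by (simp add: mat_bracket_def[of "mat_bracket _ _"] mat_mult_def mat_bracket_b_c sum_5 ad_pow_mat_c)

lemma mat_bracket_family_right_0: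
  assumes "i < 5"
  shows "mat_bracket (mat_bracket mat_b mat_c) (ad_pow mat_bracket mat_a n mat_c) 0 i = 0"
  by (simp add: mat_bracket_def[of "mat_bracket _ _"] mat_mult_def mat_bracket_b_c sum_5
      ad_pow_mat_c_0_1)

text \<open>Each kind reads off one entry of \<open>M\<close>, multiplied by a power of a weight
  difference or by the entry of an iterated bracket.\<close>

lemma family_corner:
  "family mat_bracket mat_a mat_b mat_c KX i M 0 4 = poly_X ^ i * M 1 4"
  "family mat_bracket mat_a mat_b mat_c KY i M 0 4 = poly_Y ^ i * M 0 3"
  "family mat_bracket mat_a mat_b mat_c ZX i M 0 4 = poly_X ^ i * M 3 4"
  "family mat_bracket mat_a mat_b mat_c ZY i M 0 4 = poly_Y ^ i * M 0 1"
proof -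
  let ?r = "rad_pow mat_bracket mat_a i M"
  have "family mat_bracket mat_a mat_b mat_c KX i M 0 4 = ?r 1 4"
    by (simp add: mat_bracket_def[of mat_b] mat_mult_def sum_5 mat_b_def)
  then show "family mat_bracket mat_a mat_b mat_c KX i M 0 4 = poly_X ^ i * M 1 4"
    by (simp add: rad_pow_mat_a) (simp add: weight_def)
  have "family mat_bracket mat_a mat_b mat_c KY i M 0 4 = ?r 0 3"
    by (simp add: mat_bracket_def[of _ mat_c] mat_mult_def sum_5 mat_c_def)
  then show "family mat_bracket mat_a mat_b mat_c KY i M 0 4 = poly_Y ^ i * M 0 3"
    by (simp add: rad_pow_mat_a) (simp add: weight_def)
  show "family mat_bracket mat_a mat_b mat_c ZX i M 0 4 = poly_X ^ i * M 3 4"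
    by (simp add: mat_bracket_def[of _ M] mat_mult_def sum_5
        mat_bracket_family_left mat_bracket_family_left_4)
  show "family mat_bracket mat_a mat_b mat_c ZY i M 0 4 = poly_Y ^ i * M 0 1"
    by (simp add: mat_bracket_def[of M] mat_mult_def sum_5
        mat_bracket_family_right mat_bracket_family_right_0)
qed

lemma config_corner: "config mat_bracket mat_a mat_b mat_c (i, j) 0 4 = poly_X ^ i * poly_Y ^ j"
  by (simp add: mat_bracket_def[of "ad_pow _ _ _ _"] mat_mult_def sum_5 ad_pow_mat_b
      mat_bracket_family_right mat_bracket_family_right_0)

text \<open>For \<open>KX\<close> and \<open>KY\<close> the power is absorbed by a shift of
  \<open>g\<close>. For \<open>ZX\<close> and \<open>ZY\<close> the restricted entry lacks the
  pinned variable, so only values of \<open>g\<close> at points of the rule occur.\<close>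

lemma coeff_sum_family:
  assumes M: "restricted M" and inv: "\<And>x y. g (point k i x y) = g' (point k j x y)"
  shows "coeff_sum g (family mat_bracket mat_a mat_b mat_c k i M 0 4) =
    coeff_sum g' (family mat_bracket mat_a mat_b mat_c k j M 0 4)"
proof (cases k)
  case KX
  then show ?thesis using inv by (simp only: family_corner coeff_sum_mult_X_power) simp
next
  case KY
  then show ?thesis using inv by (simp only: family_corner coeff_sum_mult_Y_power) simp
next
  case ZX
  have "Y_only (M 3 4)" using M by (simp add: restricted_def)
  then show ?thesis unfolding ZX family_corner coeff_sum_mult_X_power
    by (rule coeff_sum_Y_only) (use inv ZX in simp)
next
  case ZY
  have "X_only (M 0 1)" using M by (simp add: restricted_def)
  then show ?thesis unfolding ZY family_corner coeff_sum_mult_Y_power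
    by (rule coeff_sum_X_only) (use inv ZY in simp)
qed

section \<open>Undecidability\<close>

text \<open>A run to a terminal configuration must begin with the unique step available. Hence
  reaching it is invariant along rules, as \<open>\<gamma>_step\<close> requires.\<close>

lemma deterministic_terminal_iff:
  assumes det: "deterministic r" and "r x y" and terminal: "\<forall>u. \<not> r z u"
  shows "r\<^sup>*\<^sup>* x z \<longleftrightarrow> r\<^sup>*\<^sup>* y z"
proof
  assume "r\<^sup>*\<^sup>* x z"
  then show "r\<^sup>*\<^sup>* y z"
  proof (cases rule: converse_rtranclpE)
    case base
    then show ?thesis using \<open>r x y\<close> terminal by simp
  next
    case (step u)
    then show ?thesis using det \<open>r x y\<close> unfolding deterministic_def by metis
  qed
next
  assume "r\<^sup>*\<^sup>* y z"
  with \<open>r x y\<close> show "r\<^sup>*\<^sup>* x z" by (rule converse_rtranclp_into_rtranclp)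
qed

lemma deterministic_terminal_unique:
  assumes det: "deterministic r" and "r\<^sup>*\<^sup>* x y" "r\<^sup>*\<^sup>* x z"
    and y: "\<forall>u. \<not> r y u" and z: "\<forall>u. \<not> r z u"
  shows "y = z"
  using assms(2,3)
proof (induction rule: converse_rtranclp_induct)
  case base
  then show ?case by (cases rule: converse_rtranclpE) (use y in auto)
next
  case (step x x')
  then show ?case using deterministic_terminal_iff[OF det step.hyps(1) z] by simp
qed

lemma (in free_lie_algebra) flow_solvable_imp_steps:
  fixes R :: "'q rule set"
  assumes det: "deterministic (rule_step R)"
    and halt: "\<And>v. \<not> rule_step R u' v" and fin: "finite Q"
    and labels: "\<And>k q i q' j. (k, q, i, q', j) \<in> R \<Longrightarrow> q \<in> Q \<and> q' \<in> Q"
      "fst u \<in> Q" "fst u' \<in> Q"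
    and distinct: "distinct [sa, sb, sc]"
    and sol: "flow_solvable (g sa) (g sb) (g sc) R Q u u'"
  shows "(rule_step R)\<^sup>*\<^sup>* u u'"
proof -
  define f :: "'x \<Rightarrow> 'k matrix" where
    "f x = (if x = sa then mat_a else if x = sb then mat_b else if x = sc then mat_c else 0)" for x
  obtain H where hom: "lie_hom scale bracket mat_scale mat_bracket H" and Hg: "\<And>x. H (g x) = f x"
    using universal_property[OF lie_algebra_matrix, of f] by blast
  have H: "H (x + y) = H x + H y" "H (scale r x) = mat_scale r (H x)"
    "H (bracket x y) = mat_bracket (H x) (H y)" for x y r
    using hom by (simp_all add: lie_hom_def)
  have H0: "H 0 = 0" using H(1)[of 0 0] by simp
  have H_gen: "H (g sa) = mat_a" "H (g sb) = mat_b" "H (g sc) = mat_c"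
    using distinct by (auto simp: Hg f_def)
  have restricted_f: "restricted (f x)" for x
    unfolding f_def using restricted_generators restricted_0
    by (cases "x = sa"; cases "x = sb"; cases "x = sc") (simp_all only: if_True if_False simp_thms)
  have restricted: "restricted (H v)" for v
  proof -
    obtain t where "lie_eval scale bracket g t = v" using generating by blast
    moreover have "restricted (H (lie_eval scale bracket g t))"
      by (induction t) (simp_all only: lie_eval.simps H H0 Hg restricted_f restricted_0
          restricted_add restricted_scale restricted_bracket)
    ultimately show ?thesis by simp
  qed
  \<comment> \<open>The indicator of the configurations from which the machine halts in
    \<open>u'\<close>; as the argument of \<open>coeff_sum\<close> it defines the functional \<phi>
    on corner entries.\<close>
  define \<gamma> :: "'q \<Rightarrow> nat \<times> nat \<Rightarrow> 'k" where
    "\<gamma> q p = (if (rule_step R)\<^sup>*\<^sup>* (q, p) u' then 1 else 0)" for q p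
  define \<phi> where "\<phi> q v = coeff_sum (\<gamma> q) (H v 0 4)" for q v
  have \<phi>_add: "\<phi> q (x + y) = \<phi> q x + \<phi> q y" for q x y
    by (simp add: \<phi>_def H coeff_sum_add)
  have \<phi>_0: "\<phi> q 0 = 0" for q by (simp add: \<phi>_def H0 coeff_sum_0)
  have \<phi>_sum: "\<phi> q (\<Sum>x\<in>A. h x) = (\<Sum>x\<in>A. \<phi> q (h x))" for q A and h :: "'q rule \<Rightarrow> 'l"
    by (induction A rule: infinite_finite_induct) (simp_all add: \<phi>_0 \<phi>_add)
  have \<phi>_residual: "\<phi> q (bracket (g sa) z) = 0"
    "\<phi> q (bracket (bracket (g sb) (g sc)) z) = 0" for q z
    by (simp_all add: \<phi>_def H H_gen mat_bracket_corner_zero coeff_sum_0)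
  have \<phi>_config: "\<phi> q (config bracket (g sa) (g sb) (g sc) p) = \<gamma> q p" for q p
    by (cases p) (simp add: \<phi>_def config_hom[of H bracket mat_bracket, OF H(3)] H_gen
        config_corner coeff_sum_monomial del: config.simps)
  have \<gamma>_step: "\<gamma> q (point k i x y) = \<gamma> q' (point k j x y)" if "(k, q, i, q', j) \<in> R" for k q i q' j x y
  proof -
    have step: "rule_step R (q, point k i x y) (q', point k j x y)"
      using that by (rule rule_step.intros)
    then have "(rule_step R)\<^sup>*\<^sup>* (q, point k i x y) u' \<longleftrightarrow> (rule_step R)\<^sup>*\<^sup>* (q', point k j x y) u'"
      using halt by (intro deterministic_terminal_iff[OF det]) auto
    then show ?thesis by (simp add: \<gamma>_def)
  qed
  let ?F = "\<lambda>k i v. family bracket (g sa) (g sb) (g sc) k i v"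
  have \<phi>_family: "\<phi> q (?F k i v) = \<phi> q' (?F k j v)" if "(k, q, i, q', j) \<in> R" for k q i q' j v
    unfolding \<phi>_def family_hom[of H bracket mat_bracket, OF H(3)] H_gen
    using restricted \<gamma>_step[OF that] by (rule coeff_sum_family)
  obtain V Z Z' where eq: "\<And>q. q \<in> Q \<Longrightarrow>
      outflow (g sa) (g sb) (g sc) R V q +
        (bracket (g sa) (Z q) + bracket (bracket (g sb) (g sc)) (Z' q)) +
        placed (g sa) (g sb) (g sc) u' q =
      inflow (g sa) (g sb) (g sc) R V q + placed (g sa) (g sb) (g sc) u q"
    using sol unfolding flow_solvable_def by blast
  \<comment> \<open>Summed over \<open>Q\<close>, each rule counts once at its source and once at
    its target, and \<open>\<phi>_family\<close> identifies the two contributions.\<close>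
  have "(\<Sum>q\<in>Q. \<phi> q (outflow (g sa) (g sb) (g sc) R V q)) =
      (\<Sum>q\<in>Q. \<Sum>r\<in>R. case r of (k, q1, i, q2, j) \<Rightarrow> if q = q1 then \<phi> q1 (?F k i (V r)) else 0)"
    unfolding outflow_def \<phi>_sum by (intro sum.cong) (auto simp: \<phi>_0 split: prod.split)
  also have "\<dots> = (\<Sum>r\<in>R. case r of (k, q1, i, q2, j) \<Rightarrow> \<phi> q1 (?F k i (V r)))"
    using labels(1) fin by (subst sum.swap) (auto intro!: sum.cong split: prod.split)
  also have "\<dots> = (\<Sum>r\<in>R. case r of (k, q1, i, q2, j) \<Rightarrow> \<phi> q2 (?F k j (V r)))"
    using \<phi>_family by (intro sum.cong) (auto split: prod.split)
  also have "\<dots> = (\<Sum>q\<in>Q. \<Sum>r\<in>R. case r of (k, q1, i, q2, j) \<Rightarrow>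
      if q = q2 then \<phi> q2 (?F k j (V r)) else 0)"
    using labels(1) fin by (subst sum.swap) (auto intro!: sum.cong split: prod.split)
  also have "\<dots> = (\<Sum>q\<in>Q. \<phi> q (inflow (g sa) (g sb) (g sc) R V q))"
    unfolding inflow_def \<phi>_sum by (intro sum.cong) (auto simp: \<phi>_0 split: prod.split)
  finally have flows: "(\<Sum>q\<in>Q. \<phi> q (outflow (g sa) (g sb) (g sc) R V q)) =
      (\<Sum>q\<in>Q. \<phi> q (inflow (g sa) (g sb) (g sc) R V q))" .
  have placed: "(\<Sum>q\<in>Q. \<phi> q (placed (g sa) (g sb) (g sc) w q)) = \<gamma> (fst w) (snd w)"
    if "fst w \<in> Q" for w
  proof -
    have "(\<Sum>q\<in>Q. \<phi> q (placed (g sa) (g sb) (g sc) w q)) =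
        (\<Sum>q\<in>Q. if q = fst w then \<gamma> (fst w) (snd w) else 0)"
      by (rule sum.cong) (auto simp: placed_def \<phi>_0 \<phi>_config)
    then show ?thesis using that fin by simp
  qed
  have "\<phi> q (outflow (g sa) (g sb) (g sc) R V q) + \<phi> q (placed (g sa) (g sb) (g sc) u' q) =
      \<phi> q (inflow (g sa) (g sb) (g sc) R V q) + \<phi> q (placed (g sa) (g sb) (g sc) u q)"
    if "q \<in> Q" for q
    using arg_cong[OF eq[OF that], of "\<phi> q"] by (simp only: \<phi>_add \<phi>_residual add_0_right)
  then have "(\<Sum>q\<in>Q. \<phi> q (outflow (g sa) (g sb) (g sc) R V q) + \<phi> q (placed (g sa) (g sb) (g sc) u' q)) =
      (\<Sum>q\<in>Q. \<phi> q (inflow (g sa) (g sb) (g sc) R V q) + \<phi> q (placed (g sa) (g sb) (g sc) u q))"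
    by (rule sum.cong[OF HOL.refl])
  \<comment> \<open>The left side is 1 by the empty run. Since 1 differs from 0 in every field,
    \<open>u\<close> reaches \<open>u'\<close> whatever the characteristic.\<close>
  then have "\<gamma> (fst u') (snd u') = \<gamma> (fst u) (snd u)"
    unfolding sum.distrib flows placed[OF labels(2)] placed[OF labels(3)] by simp
  then show ?thesis by (simp add: \<gamma>_def split: if_splits)
qed

section \<open>The equations as terms and their codes\<close>

instance kind :: countable by countable_datatype

instance com :: countable by countable_datatype

abbreviation "Var n \<equiv> Atom (Inl n)"

definition sum_term :: "('k, 'a) lie_term list \<Rightarrow> ('k, 'a) lie_term" where
  "sum_term ts = foldr Add ts Zero"

definition input_var :: nat where
  "input_var = prod_encode (3, 0)"

text \<open>The start configuration refers to ad_a^N b only through \<open>input_var\<close>, so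
  these equations do not depend on the input \<open>N\<close>. The tags 0 to 3 in the variable
  numbers keep the sorts of unknowns apart.\<close>

definition flow_equation ::
  "nat \<Rightarrow> nat \<Rightarrow> nat \<Rightarrow> 'q::countable rule list \<Rightarrow> 'q \<Rightarrow> 'q \<Rightarrow> 'q \<Rightarrow> (nat, nat) lie_equation" where
  "flow_equation ia ib ic rs q0 h q = (let a = Atom (Inr ia); b = Atom (Inr ib); c = Atom (Inr ic);
      V = (\<lambda>r. Var (prod_encode (0, to_nat r))) in
    (Add (Add (sum_term (map (\<lambda>r. case r of (k, q1, i, q2, j) \<Rightarrow>
            if q1 = q then family Bracket a b c k i (V r) else Zero) rs))
          (Add (Bracket a (Var (prod_encode (1, to_nat q))))
            (Bracket (Bracket b c) (Var (prod_encode (2, to_nat q))))))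
       (if q = h then config Bracket a b c (1, 0) else Zero),
     Add (sum_term (map (\<lambda>r. case r of (k, q1, i, q2, j) \<Rightarrow>
            if q2 = q then family Bracket a b c k j (V r) else Zero) rs))
       (if q = q0 then Bracket (Var input_var) (Bracket (Bracket b c) c) else Zero)))"

definition input_equation :: "nat \<Rightarrow> nat \<Rightarrow> nat \<Rightarrow> (nat, nat) lie_equation" where
  "input_equation ia ib N = (Var input_var, ad_pow Bracket (Atom (Inr ia)) N (Atom (Inr ib)))"

lemma lie_eval_interpret_term:
  "lie_eval scale bracket (case_sum v id) (interpret_term \<sigma> \<nu> t) =
    lie_eval (\<lambda>i. scale (\<sigma> i)) bracket (case_sum v \<nu>) t"
proof (induction t)
  case (Atom x)
  then show ?case by (cases x) (simp_all add: interpret_term_def)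
qed (simp_all add: interpret_term_def)

lemma lie_eval_sum_term:
  "lie_eval scale bracket f (sum_term ts) = sum_list (map (lie_eval scale bracket f) ts)"
  by (induction ts) (simp_all add: sum_term_def)

text \<open>Evaluation commutes with \<open>family\<close> and \<open>config\<close>, and
  distinctness of \<open>rs\<close> turns list sums into sums over the rule set.\<close>

lemma (in lie_algebra) has_solution_flow_iff:
  fixes rs :: "'q::countable rule list"
  assumes "distinct rs"
  shows "has_solution scale bracket (map (map_prod (interpret_term \<sigma> \<nu>) (interpret_term \<sigma> \<nu>))
      (input_equation ia ib N # map (flow_equation ia ib ic rs q0 h) qs)) \<longleftrightarrow>
    flow_solvable (\<nu> ia) (\<nu> ib) (\<nu> ic) (set rs) (set qs) (q0, N, 0) (h, 1, 0)"
    (is "?lhs \<longleftrightarrow> ?rhs")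
proof -
  let ?a = "\<nu> ia" and ?b = "\<nu> ib" and ?c = "\<nu> ic"
  let ?e = "\<lambda>v. lie_eval (\<lambda>i. scale (\<sigma> i)) bracket (case_sum v \<nu>)"
  let ?V = "\<lambda>v (r :: 'q rule). v (prod_encode (0, to_nat r))"
  let ?Z = "\<lambda>v (q :: 'q). v (prod_encode (1, to_nat q))"
  let ?Z' = "\<lambda>v (q :: 'q). v (prod_encode (2, to_nat q))"
  have family: "?e v (family Bracket (Atom (Inr ia)) (Atom (Inr ib)) (Atom (Inr ic)) k i t) =
      family bracket ?a ?b ?c k i (?e v t)" for v k i t
    by (subst family_hom[of "?e v" Bracket bracket]) simp_all
  have config: "?e v (config Bracket (Atom (Inr ia)) (Atom (Inr ib)) (Atom (Inr ic)) p) =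
      config bracket ?a ?b ?c p" for v p
    by (subst config_hom[of "?e v" Bracket bracket]) simp_all
  have ad: "?e v (ad_pow Bracket (Atom (Inr ia)) N (Atom (Inr ib))) = ad_pow bracket ?a N ?b" for v
    by (subst ad_pow_hom[of "?e v" Bracket bracket]) simp_all
  have left: "?e v (fst (flow_equation ia ib ic rs q0 h q)) =
      outflow ?a ?b ?c (set rs) (?V v) q + (bracket ?a (?Z v q) + bracket (bracket ?b ?c) (?Z' v q)) +
      placed ?a ?b ?c (h, 1, 0) q" for v q
    using assms
    by (auto simp: flow_equation_def Let_def lie_eval_sum_term outflow_def placed_def config
        sum_list_distinct_conv_sum_set family comp_def intro!: sum.cong split: prod.split
        simp del: config.simps)
  have right: "?e v (snd (flow_equation ia ib ic rs q0 h q)) =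
      inflow ?a ?b ?c (set rs) (?V v) q + placed ?a ?b ?c (q0, N, 0) q"
    if "v input_var = ad_pow bracket ?a N ?b" for v q
    using assms that
    by (auto simp: flow_equation_def Let_def lie_eval_sum_term inflow_def placed_def ad_pow_def
        sum_list_distinct_conv_sum_set family comp_def intro!: sum.cong split: prod.split)
  have "?lhs \<longleftrightarrow> (\<exists>v. v input_var = ad_pow bracket ?a N ?b \<and> (\<forall>q\<in>set qs.
      ?e v (fst (flow_equation ia ib ic rs q0 h q)) = ?e v (snd (flow_equation ia ib ic rs q0 h q))))"
    by (auto simp: has_solution_def case_prod_unfold lie_eval_interpret_term input_equation_def ad)
  also have "\<dots> \<longleftrightarrow> (\<exists>v. v input_var = ad_pow bracket ?a N ?b \<and> (\<forall>q\<in>set qs.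
      outflow ?a ?b ?c (set rs) (?V v) q + (bracket ?a (?Z v q) + bracket (bracket ?b ?c) (?Z' v q)) +
        placed ?a ?b ?c (h, 1, 0) q =
      inflow ?a ?b ?c (set rs) (?V v) q + placed ?a ?b ?c (q0, N, 0) q))"
    by (simp only: left right cong: conj_cong)
  also have "\<dots> \<longleftrightarrow> ?rhs"
  proof
    assume ?rhs
    then obtain V Z Z' where *: "\<forall>q\<in>set qs.
      outflow ?a ?b ?c (set rs) V q + (bracket ?a (Z q) + bracket (bracket ?b ?c) (Z' q)) +
        placed ?a ?b ?c (h, 1, 0) q =
      inflow ?a ?b ?c (set rs) V q + placed ?a ?b ?c (q0, N, 0) q"
      unfolding flow_solvable_def by blast
    \<comment> \<open>The last branch covers tag 3, the input variable.\<close>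
    define v where "v n = (case prod_decode n of (i, m) \<Rightarrow>
        if i = 0 then V (from_nat m) else if i = 1 then Z (from_nat m)
        else if i = 2 then Z' (from_nat m) else ad_pow bracket ?a N ?b)" for n
    have v: "?V v = V" "?Z v = Z" "?Z' v = Z'" "v input_var = ad_pow bracket ?a N ?b"
      by (auto simp: v_def input_var_def)
    show "\<exists>v. v input_var = ad_pow bracket ?a N ?b \<and> (\<forall>q\<in>set qs.
      outflow ?a ?b ?c (set rs) (?V v) q + (bracket ?a (?Z v q) + bracket (bracket ?b ?c) (?Z' v q)) +
        placed ?a ?b ?c (h, 1, 0) q =
      inflow ?a ?b ?c (set rs) (?V v) q + placed ?a ?b ?c (q0, N, 0) q)"
      using *[folded v(1-3)] v(4) by blast
  next
    assume "\<exists>v. v input_var = ad_pow bracket ?a N ?b \<and> (\<forall>q\<in>set qs.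
      outflow ?a ?b ?c (set rs) (?V v) q + (bracket ?a (?Z v q) + bracket (bracket ?b ?c) (?Z' v q)) +
        placed ?a ?b ?c (h, 1, 0) q =
      inflow ?a ?b ?c (set rs) (?V v) q + placed ?a ?b ?c (q0, N, 0) q)"
    then obtain v where "\<forall>q\<in>set qs.
      outflow ?a ?b ?c (set rs) (?V v) q + (bracket ?a (?Z v q) + bracket (bracket ?b ?c) (?Z' v q)) +
        placed ?a ?b ?c (h, 1, 0) q =
      inflow ?a ?b ?c (set rs) (?V v) q + placed ?a ?b ?c (q0, N, 0) q"
      by blast
    then show ?rhs unfolding flow_solvable_def
      by (intro exI[of _ "?V v"] exI[of _ "?Z v"] exI[of _ "?Z' v"])
  qed
  finally show ?thesis .
qed

text \<open>Prepending an equation keeps the code of \<open>E\<close> as the tail of the list code,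
  so \<open>E\<close> need not be decoded; the code of the input term is an iterate of
  \<open>?code\<close>.\<close>

lemma substitution_recursive:
  obtains s where "\<And>E. computes s [system_code E]
    (system_code (input_equation ia ib (p ^ system_code E) # E))"
proof -
  let ?code = "\<lambda>u. prod_encode (4, prod_encode (term_code (Atom (Inr ia)), u))"
  have term_code: "term_code (ad_pow Bracket (Atom (Inr ia)) N t) = (?code ^^ N) (term_code t)" for N t
    by (induction N) (simp_all add: ad_pow_def)
  have "total_recursive 1 (\<lambda>xs. Suc (prod_encode (prod_encode (term_code (Var input_var),
      (?code ^^ (p ^ (xs ! 0))) (term_code (Atom (Inr ib)))), xs ! 0)))"
    by (intro total_recursive_Suc total_recursive_prod_encode total_recursive_const
        total_recursive_funpow total_recursive_power total_recursive_proj) simp_all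
  then obtain s where s: "\<And>xs. length xs = 1 \<Longrightarrow>
      computes s xs (Suc (prod_encode (prod_encode (term_code (Var input_var),
        (?code ^^ (p ^ (xs ! 0))) (term_code (Atom (Inr ib)))), xs ! 0)))"
    unfolding total_recursive_def by blast
  have "computes s [system_code E] (system_code (input_equation ia ib (p ^ system_code E) # E))" for E
    using s[of "[system_code E]"]
    by (simp add: system_code_def input_equation_def term_code del: term_code.simps)
  then show thesis by (rule that)
qed

theorem theorem5:
  fixes scale :: "'k::field \<Rightarrow> 'l::ab_group_add \<Rightarrow> 'l"
    and bracket :: "'l \<Rightarrow> 'l \<Rightarrow> 'l"
    and g :: "'x \<Rightarrow> 'l"
    and \<sigma> :: "nat \<Rightarrow> 'k"
    and \<nu> :: "nat \<Rightarrow> 'l"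
  assumes free: "free_lie_algebra scale bracket g"
    and rank: "infinite (UNIV :: 'x set) \<or> card (UNIV :: 'x set) > 2"
    and scalars: "computable_numbering \<sigma>"
    and constants: "computable_numbering \<nu>"
    and generators: "\<exists>S. card S = 3 \<and> g ` S \<subseteq> range \<nu>"
  shows "\<not> diophantine_problem_decidable scale bracket \<sigma> \<nu>"
proof
  interpret free_lie_algebra scale bracket g by fact
  let ?interp = "map (map_prod (interpret_term \<sigma> \<nu>) (interpret_term \<sigma> \<nu>))"
  assume "diophantine_problem_decidable scale bracket \<sigma> \<nu>"
  then obtain f where f: "\<And>E. computes f [system_code E]
      (if has_solution scale bracket (?interp E) then 1 else 0)"
    unfolding diophantine_problem_decidable_def decidable_via_def by blast
  obtain S where S: "card S = 3" "g ` S \<subseteq> range \<nu>" using generators by blast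
  then obtain sa sb sc where s: "S = {sa, sb, sc}" "distinct [sa, sb, sc]"
    by (auto simp: card_3_iff)
  then obtain ia ib ic where i: "g sa = \<nu> ia" "g sb = \<nu> ib" "g sc = \<nu> ic"
    using S(2) by (auto simp: image_subset_iff image_iff)
  let ?p = "nth_prime 0"
  obtain sub where sub: "\<And>E. computes sub [system_code E]
      (system_code (input_equation ia ib (?p ^ system_code E) # E))"
    using substitution_recursive by blast
  obtain R q0 h where R: "finite R"
    and det: "deterministic (rule_step R)"
    and halt: "\<forall>u v. \<not> rule_step R (h :: nat \<times> com list, u) v"
    and run: "\<forall>n y. computes (RComp f [sub]) [n] y \<longrightarrow> (\<exists>N.
      (rule_step R)\<^sup>*\<^sup>* (q0, ?p ^ n, 0) (h, N, 0) \<and> (N = 1 \<longleftrightarrow> y = 0))"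
    by (rule recf_two_counter)
  define Q where "Q = {q0, h} \<union> (\<lambda>(k, q, i, q', j). q) ` R \<union> (\<lambda>(k, q, i, q', j). q') ` R"
  have "finite Q" using R by (simp add: Q_def)
  then obtain qs where qs: "set qs = Q" using finite_list by blast
  obtain rs where rs: "set rs = R" "distinct rs" using finite_distinct_list[OF R] by blast
  define E where "E = map (flow_equation ia ib ic rs q0 h) qs"
  \<comment> \<open>The diagonal point: \<open>E\<close> comes from the machine for
    \<open>RComp f [sub]\<close>, and on input \<open>n\<close> this machine decides the solvability
    of \<open>?E\<close>, the system describing that very run.\<close>
  define n where "n = system_code E"
  let ?E = "input_equation ia ib (?p ^ n) # E"
  let ?solvable = "has_solution scale bracket (?interp ?E)"
  have solvable_iff: "?solvable \<longleftrightarrow>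
      flow_solvable (g sa) (g sb) (g sc) R Q (q0, ?p ^ n, 0) (h, 1, 0)"
    unfolding E_def has_solution_flow_iff[OF rs(2)] i rs(1) qs ..
  have "computes (RComp f [sub]) [n] (if ?solvable then 1 else 0)"
    using sub[of E] f[of ?E] unfolding n_def by (intro computes.comp) auto
  with run obtain N where N: "(rule_step R)\<^sup>*\<^sup>* (q0, ?p ^ n, 0) (h, N, 0)"
    "N = 1 \<longleftrightarrow> (if ?solvable then 1 else 0) = (0 :: nat)" by blast
  show False
  \<comment> \<open>If \<open>?E\<close> is solvable, the machine outputs 1 and stops with
    \<open>N\<close> other than 1, yet the solution forces it to reach \<open>(h, 1, 0)\<close>. If
    not, it stops in \<open>(h, 1, 0)\<close>, and the run provides a solution.\<close>
  proof (cases ?solvable)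
    case True
    have "(rule_step R)\<^sup>*\<^sup>* (q0, ?p ^ n, 0) (h, 1, 0)"
    proof (rule flow_solvable_imp_steps[OF det _ \<open>finite Q\<close> _ _ _ s(2) True[unfolded solvable_iff]])
      show "q \<in> Q \<and> q' \<in> Q" if "(k, q, i, q', j) \<in> R" for k q i q' j
        using that by (force simp: Q_def)
      show "\<not> rule_step R (h, 1, 0) v" for v
        using halt by blast
    qed (simp_all add: Q_def)
    from deterministic_terminal_unique[OF det N(1) this] have "N = 1"
      using halt by blast
    then show False using N(2) True by simp
  next
    case False
    then have "linked (g sa) (g sb) (g sc) R (q0, ?p ^ n, 0) (h, 1, 0)"
      using N linked_steps[OF _ R] by simp
    then show False
      using False flow_solvable_if_linked solvable_iff by blast
  qed
qed

end
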